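(* A function $f\in\tilde C^\infty_e(S^2)$ is recovered from its vertical slice transform by \[ f(x)=\frac{|x_3|}{8\pi^2}\,\Delta\int_{S^1}d\sigma(\theta)\int_{-1}^1(Vf)(\theta,t)\frac{\log|t-\theta\cdot x'|}{\sqrt{1-t^2}}\,dt \] for every $x=(x',x_3)\in S^2$ with $|x'|<1$, where $\Delta$ is the Laplacian in $x'\in\mathbb{R}^2$.
   Context: Points of $\mathbb{R}^3$ are written $x=(x',x_3)$, $x'\in\mathbb{R}^2$; $S^2$ the unit sphere; $S^1$ the unit circle with arc length $d\sigma$. $\tilde C^\infty_e(S^2)$: $C^\infty$ functions on $S^2$ even in $x_3$ and vanishing identically in a neighborhood of the equator $\{x_3=0\}$. Vertical slice transform: $(Vf)(\theta,t)=\int_{\{x\in S^2:x'\cdot\theta=t\}}f(x)\,d_\tau\sigma(x)$ for $\theta\in S^1$, $t\in(-1,1)$, with arc length on the circle of intersection. *)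

theory Defs
  imports "HOL-Analysis.Analysis"
begin

text \<open>Points of R^3 are written x = (x', x3) with x' :: real * real, i.e. R^3 is
  modelled by the Euclidean space (real * real) * real.\<close>

coinductive smooth_on :: "'a::euclidean_space set \<Rightarrow> ('a \<Rightarrow> real) \<Rightarrow> bool" for U where
  "\<lbrakk> continuous_on U g;
     \<And>i. i \<in> Basis \<Longrightarrow> \<forall>x\<in>U. ((\<lambda>s. g (x + s *\<^sub>R i)) has_real_derivative dg i x) (at 0);
     \<And>i. i \<in> Basis \<Longrightarrow> smooth_on U (dg i) \<rbrakk> \<Longrightarrow> smooth_on U g"

definition smooth_on_S2 :: "((real \<times> real) \<times> real \<Rightarrow> real) \<Rightarrow> bool" where
  "smooth_on_S2 f \<longleftrightarrow> (\<exists>U g. open U \<and> sphere 0 1 \<subseteq> U \<and> smooth_on U g \<and>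
       (\<forall>x\<in>sphere 0 1. f x = g x))"

definition Ctilde_e :: "((real \<times> real) \<times> real \<Rightarrow> real) set" where
  "Ctilde_e = {f. smooth_on_S2 f
      \<and> (\<forall>x' x3. ((x', x3) \<in> sphere 0 1) \<longrightarrow> f (x', - x3) = f (x', x3))
      \<and> (\<exists>\<epsilon>>0. \<forall>x' x3. (x', x3) \<in> sphere 0 1 \<and> \<bar>x3\<bar> < \<epsilon> \<longrightarrow> f (x', x3) = 0)}"

definition arc_integral :: "(real \<Rightarrow> 'a::euclidean_space) \<Rightarrow> real \<Rightarrow> real \<Rightarrow> ('a \<Rightarrow> real) \<Rightarrow> real" where
  "arc_integral \<gamma> a b h = (LBINT s=a..b. h (\<gamma> s) * norm (vector_derivative \<gamma> (at s)))"

definition circ :: "real \<Rightarrow> real \<times> real" where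
  "circ \<alpha> = (cos \<alpha>, sin \<alpha>)"

text \<open>Parametrisation of the circle {x in S^2 : x' . theta = t} (theta in S^1, |t|<1):
  centre (t theta, 0), radius sqrt(1-t^2), spanned by theta-perp and e3.\<close>
definition slice_circ :: "real \<times> real \<Rightarrow> real \<Rightarrow> real \<Rightarrow> (real \<times> real) \<times> real" where
  "slice_circ \<theta> t \<phi> = (let r = sqrt (1 - t\<^sup>2) in
      (t *\<^sub>R \<theta> + (r * cos \<phi>) *\<^sub>R (- snd \<theta>, fst \<theta>), r * sin \<phi>))"

definition V :: "((real \<times> real) \<times> real \<Rightarrow> real) \<Rightarrow> real \<times> real \<Rightarrow> real \<Rightarrow> real" where
  "V f \<theta> t = arc_integral (slice_circ \<theta> t) 0 (2 * pi) f"

definition laplacian :: "('a::euclidean_space \<Rightarrow> real) \<Rightarrow> 'a \<Rightarrow> real" where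
  "laplacian u p = (\<Sum>i\<in>Basis. deriv (deriv (\<lambda>s. u (p + s *\<^sub>R i))) 0)"

definition has_second_partials :: "('a::euclidean_space \<Rightarrow> real) \<Rightarrow> 'a \<Rightarrow> bool" where
  "has_second_partials u p \<longleftrightarrow> (\<forall>i\<in>Basis.
      (\<forall>\<^sub>F s in nhds 0. (\<lambda>s. u (p + s *\<^sub>R i)) differentiable (at s))
      \<and> deriv (\<lambda>s. u (p + s *\<^sub>R i)) differentiable (at 0))"

end

theory Submission
  imports Defs "HOL-Real_Asymp.Real_Asymp" "HOL-Probability.Sinc_Integral"
begin

text \<open>
  Write $f(x', x_3) = |x_3| h(x')$ on the sphere; then $h$ is twice continuously differentiable
  on the plane and vanishes outside the unit disc. The substitution $s = r \cos\phi$ turns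
  $V f$ into $2 \sqrt{1-t^2}$ times the Radon transform of $h$, so the weight cancels and
  the double integral becomes
  $2 \int d\theta \int\int \log|t|\, h(y + t\theta + s\theta^\perp)\, ds\, dt$.
  Instead of polar coordinates in the plane we put $s = t u$, exchange the integrals and
  rescale $w = t \sqrt{1+u^2}$; since
  $\theta + u\theta^\perp$ is $\sqrt{1+u^2}$ times $\theta$ rotated by $\arctan u$, the
  integral becomes $\int K(w) \int h(y + w\theta)\, d\theta\, dw$ with the continuous kernel
  $K(w) = 2|w| (\pi \log|w| - c)$ for some constant $c$. One may now differentiate under the
  integral sign. In polar form, the circular mean $M(w)$ of $h$ satisfies
  $w \cdot {}$(mean of the Laplacian) $= (w M')'$, and
  $(\pi \log w - c)\, w M' - \pi M$ is an explicit antiderivative of the remaining integrand.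
\<close>

section \<open>Smoothness of the planar density\<close>

text \<open>A finite-order counterpart of the coinductive \<open>smooth_on\<close>, so that sums,
  products and compositions can be handled by induction on the order. The recursion asks for a total
  derivative rather than for two partial derivatives, which makes the chain rule available.\<close>

primrec Ck :: "nat \<Rightarrow> (real \<times> real) set \<Rightarrow> (real \<times> real \<Rightarrow> real) \<Rightarrow> bool" where
  "Ck 0 S u = continuous_on S u"
| "Ck (Suc k) S u = (\<exists>u1 u2.
      (\<forall>x\<in>S. (u has_derivative (\<lambda>v. fst v * u1 x + snd v * u2 x)) (at x)) \<and> Ck k S u1 \<and> Ck k S u2)"

lemma Ck_SucI:
  assumes "\<And>x. x \<in> S \<Longrightarrow> (u has_derivative (\<lambda>v. fst v * u1 x + snd v * u2 x)) (at x)"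
    and "Ck k S u1" "Ck k S u2"
  shows "Ck (Suc k) S u"
  unfolding Ck.simps using assms by blast

lemma Ck_SucE:
  assumes "Ck (Suc k) S u"
  obtains u1 u2 where "\<And>x. x \<in> S \<Longrightarrow> (u has_derivative (\<lambda>v. fst v * u1 x + snd v * u2 x)) (at x)"
    and "Ck k S u1" "Ck k S u2"
  using assms unfolding Ck.simps by blast

lemma Ck_continuous_on: "Ck k S u \<Longrightarrow> continuous_on S u"
proof (cases k)
  case (Suc j)
  assume "Ck k S u"
  from this[unfolded Suc] obtain u1 u2
    where "\<And>x. x \<in> S \<Longrightarrow> (u has_derivative (\<lambda>v. fst v * u1 x + snd v * u2 x)) (at x)"
      "Ck j S u1" "Ck j S u2"
    by (rule Ck_SucE) (rule that)
  then show ?thesis by (intro continuous_at_imp_continuous_on ballI has_derivative_continuous)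
qed simp

lemma Ck_SucD: "Ck (Suc k) S u \<Longrightarrow> Ck k S u"
proof (induction k arbitrary: u)
  case 0
  then show ?case using Ck_continuous_on[OF 0] by simp
next
  case (Suc k)
  from Suc.prems obtain u1 u2
    where u: "\<And>x. x \<in> S \<Longrightarrow> (u has_derivative (\<lambda>v. fst v * u1 x + snd v * u2 x)) (at x)"
      "Ck (Suc k) S u1" "Ck (Suc k) S u2"
    by (rule Ck_SucE) (rule that)
  then show ?case by (intro Ck_SucI[OF u(1)] Suc.IH u(2,3))
qed

lemma Ck_const: "Ck k S (\<lambda>x. c)"
proof (induction k arbitrary: c)
  case (Suc k)
  show ?case
    by (rule Ck_SucI[where ?u1.0="\<lambda>x. 0" and ?u2.0="\<lambda>x. 0"]) (simp_all add: Suc)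
qed simp

lemma Ck_fst: "Ck k S fst"
proof (cases k)
  case (Suc j)
  show ?thesis unfolding Suc
    by (rule Ck_SucI[where ?u1.0="\<lambda>x. 1" and ?u2.0="\<lambda>x. 0"])
      (auto intro!: Ck_const derivative_eq_intros)
qed (auto intro: continuous_intros)

lemma Ck_snd: "Ck k S snd"
proof (cases k)
  case (Suc j)
  show ?thesis unfolding Suc
    by (rule Ck_SucI[where ?u1.0="\<lambda>x. 0" and ?u2.0="\<lambda>x. 1"])
      (auto intro!: Ck_const derivative_eq_intros)
qed (auto intro: continuous_intros)

lemma Ck_add: "Ck k S u \<Longrightarrow> Ck k S w \<Longrightarrow> Ck k S (\<lambda>x. u x + w x)"
proof (induction k arbitrary: u w)
  case 0
  then show ?case by (auto intro: continuous_intros)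
next
  case (Suc k)
  from Suc.prems(1) obtain u1 u2
    where u: "\<And>x. x \<in> S \<Longrightarrow> (u has_derivative (\<lambda>v. fst v * u1 x + snd v * u2 x)) (at x)"
      "Ck k S u1" "Ck k S u2" by (rule Ck_SucE) (rule that)
  from Suc.prems(2) obtain w1 w2
    where w: "\<And>x. x \<in> S \<Longrightarrow> (w has_derivative (\<lambda>v. fst v * w1 x + snd v * w2 x)) (at x)"
      "Ck k S w1" "Ck k S w2" by (rule Ck_SucE) (rule that)
  show ?case
    by (rule Ck_SucI[where ?u1.0="\<lambda>x. u1 x + w1 x" and ?u2.0="\<lambda>x. u2 x + w2 x"])
      (auto intro!: derivative_eq_intros u w Suc.IH simp: algebra_simps)
qed

lemma Ck_mult: "Ck k S u \<Longrightarrow> Ck k S w \<Longrightarrow> Ck k S (\<lambda>x. u x * w x)"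
proof (induction k arbitrary: u w)
  case 0
  then show ?case by (auto intro: continuous_intros)
next
  case (Suc k)
  from Suc.prems(1) obtain u1 u2
    where u: "\<And>x. x \<in> S \<Longrightarrow> (u has_derivative (\<lambda>v. fst v * u1 x + snd v * u2 x)) (at x)"
      "Ck k S u1" "Ck k S u2" by (rule Ck_SucE) (rule that)
  from Suc.prems(2) obtain w1 w2
    where w: "\<And>x. x \<in> S \<Longrightarrow> (w has_derivative (\<lambda>v. fst v * w1 x + snd v * w2 x)) (at x)"
      "Ck k S w1" "Ck k S w2" by (rule Ck_SucE) (rule that)
  show ?case
    by (rule Ck_SucI[where ?u1.0="\<lambda>x. u1 x * w x + u x * w1 x" and ?u2.0="\<lambda>x. u2 x * w x + u x * w2 x"])
      (auto intro!: derivative_eq_intros u w Suc.IH Ck_add Suc.prems[THEN Ck_SucD] simp: algebra_simps)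
qed

text \<open>The open disc and the open set \<open>a < norm x\<close> cover the plane, and the two
  pieces of the function agree on the overlapping annulus. The induction goes through because
  \<open>u\<close> is locally constant on that annulus, so its partial derivatives vanish there as
  well.\<close>

lemma Ck_extend_zero:
  assumes "a < 1" "Ck k (ball 0 1) u" "\<And>x. a < norm x \<Longrightarrow> norm x < 1 \<Longrightarrow> u x = 0"
  shows "Ck k UNIV (\<lambda>x. if norm x < 1 then u x else 0)"
  using assms(2,3)
proof (induction k arbitrary: u)
  case 0
  have op: "open {x::real\<times>real. a < norm x}"
    by (intro open_Collect_less continuous_intros)
  have "continuous_on (ball 0 1 \<union> {x. a < norm x}) (\<lambda>x. if norm x < 1 then u x else 0)"
  proof (rule continuous_on_open_Un)
    show "continuous_on (ball 0 1) (\<lambda>x. if norm x < 1 then u x else 0)"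
      using 0 continuous_on_cong[of "ball 0 1" "ball 0 1" u "\<lambda>x. if norm x < 1 then u x else 0"] by auto
    show "continuous_on {x. a < norm x} (\<lambda>x. if norm x < 1 then u x else 0)"
      using 0 by (subst continuous_on_cong[OF refl, of _ _ "\<lambda>x. 0"]) auto
  qed (use op in auto)
  moreover have "ball 0 1 \<union> {x::real\<times>real. a < norm x} = UNIV" using assms(1) by auto
  ultimately show ?case by simp
next
  case (Suc k)
  from Suc.prems(1) obtain u1 u2
    where u: "\<And>x. x \<in> ball 0 1 \<Longrightarrow> (u has_derivative (\<lambda>v. fst v * u1 x + snd v * u2 x)) (at x)"
      "Ck k (ball 0 1) u1" "Ck k (ball 0 1) u2" by (rule Ck_SucE) (rule that)
  have op: "open {x::real\<times>real. a < norm x \<and> norm x < 1}"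
    by (intro open_Collect_conj open_Collect_less continuous_intros)
  have z: "u1 x = 0 \<and> u2 x = 0" if "a < norm x" "norm x < 1" for x
  proof -
    have "(u has_derivative (\<lambda>v. 0)) (at x)"
      by (rule has_derivative_transform_within_open[OF has_derivative_const[of 0] op])
        (use that Suc.prems in auto)
    with u(1)[of x] that have "(\<lambda>v. fst v * u1 x + snd v * u2 x) = (\<lambda>v. 0)"
      using has_derivative_unique by (metis (no_types, lifting) mem_ball_0)
    from fun_cong[OF this, of "(1,0)"] fun_cong[OF this, of "(0,1)"] show ?thesis by simp
  qed
  show ?case
  proof (rule Ck_SucI)
    show "Ck k UNIV (\<lambda>x. if norm x < 1 then u1 x else 0)" "Ck k UNIV (\<lambda>x. if norm x < 1 then u2 x else 0)"
      using Suc.IH u z by auto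
    fix x :: "real \<times> real"
    let ?D = "\<lambda>v. fst v * (if norm x < 1 then u1 x else 0) + snd v * (if norm x < 1 then u2 x else 0)"
    show "((\<lambda>x. if norm x < 1 then u x else 0) has_derivative ?D) (at x)"
    proof (cases "norm x < 1")
      case True
      have "(u has_derivative ?D) (at x)" using u(1)[of x] True by simp
      then show ?thesis
        by (rule has_derivative_transform_within_open[of _ _ _ _ "ball 0 1"]) (use True in auto)
    next
      case False
      have "((\<lambda>x. 0) has_derivative ?D) (at x)" using False by simp
      then show ?thesis
        by (rule has_derivative_transform_within_open[of _ _ _ _ "{x. a < norm x}"])
          (use False assms(1) Suc.prems in \<open>auto intro!: open_Collect_less continuous_intros\<close>)
    qed
  qed
qed

text \<open>The passage from partial to total derivatives, adding one real coordinate at a time: a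
  total derivative in the first component at the point and a continuous partial derivative in the
  last coordinate combine to a total derivative of the pair.\<close>

lemma has_derivative_Pair_partials:
  fixes f :: "'a::euclidean_space \<times> real \<Rightarrow> real"
  assumes "open U" "p \<in> U"
    and fx: "((\<lambda>x. f (x, snd p)) has_derivative fx) (at (fst p))"
    and fy: "\<And>q. q \<in> U \<Longrightarrow> ((\<lambda>s. f (fst q, snd q + s)) has_real_derivative d q) (at 0)"
    and d: "continuous_on U d"
  shows "(f has_derivative (\<lambda>v. fx (fst v) + snd v * d p)) (at p)"
proof -
  \<comment> \<open>The neighbourhood has to be a product with a convex second factor, as
    \<open>has_derivative_partialsI\<close> demands; hence the ball \<open>B'\<close>.\<close>
  obtain A B where AB: "open A" "open B" "p \<in> A \<times> B" "A \<times> B \<subseteq> U"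
    using open_prod_elim[OF assms(1,2)] by metis
  obtain e where e: "e > 0" "ball (snd p) e \<subseteq> B"
    using AB by (metis mem_Times_iff open_contains_ball)
  define B' where "B' = ball (snd p) e"
  have sub: "A \<times> B' \<subseteq> U" using AB e B'_def by auto
  have pin: "fst p \<in> A" "snd p \<in> B'" using AB e B'_def by auto
  define fy' where "fy' = (\<lambda>x y. blinfun_scaleR_left (d (x, y)) :: real \<Rightarrow>\<^sub>L real)"
  have "((\<lambda>(x, y). f (x, y)) has_derivative (\<lambda>(tx, ty). fx tx + fy' (fst p) (snd p) ty))
     (at (fst p, snd p) within A \<times> B')"
  proof (rule has_derivative_partialsI)
    show "((\<lambda>x. f (x, snd p)) has_derivative fx) (at (fst p) within A)"
      using fx has_derivative_at_withinI by blast
    show "((\<lambda>y. f (x, y)) has_derivative blinfun_apply (fy' x y)) (at y within B')"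
      if "x \<in> A" "y \<in> B'" for x y
    proof -
      have "((\<lambda>s. f (x, y + s)) has_real_derivative d (x,y)) (at 0)"
        using fy[of "(x,y)"] that sub by auto
      then have "((\<lambda>y. f (x, y)) has_real_derivative d (x,y)) (at y)"
        using DERIV_shift[of "\<lambda>y. f (x, y)" "d (x,y)" 0 y] by (simp add: add.commute)
      then show ?thesis unfolding has_field_derivative_def fy'_def
        by (auto simp: mult.commute[of _ "d (x, y)"] intro: has_derivative_at_withinI)
    qed
    have "continuous_on (A \<times> B') (\<lambda>q. blinfun_scaleR_left (d q) :: real \<Rightarrow>\<^sub>L real)"
      by (intro bounded_linear.continuous_on[OF bounded_linear_blinfun_scaleR_left]
          continuous_on_subset[OF d sub])
    then show "continuous (at (fst p, snd p) within A \<times> B') (\<lambda>(x, y). fy' x y)"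
      using pin unfolding fy'_def case_prod_unfold prod.collapse
      by (auto simp only: continuous_on_eq_continuous_within mem_Times_iff fst_conv snd_conv prod.collapse
          dest!: bspec[where x="(fst p, snd p)"])
  qed (use pin B'_def in auto)
  moreover have "at (fst p, snd p) within A \<times> B' = at p"
    using AB pin by (auto simp: B'_def intro!: at_within_open open_Times)
  ultimately show ?thesis
    by (simp add: fy'_def case_prod_unfold)
qed

text \<open>One unfolding of \<open>smooth_on\<close> gives continuous partial derivatives along the
  three axes. \<open>has_derivative_Pair_partials\<close> is applied twice, first inside the
  horizontal plane through \<open>p\<close> (\<open>e2\<close>), then in the vertical
  direction.\<close>

lemma smooth_on_has_derivative:
  fixes g :: "(real \<times> real) \<times> real \<Rightarrow> real"
  assumes "smooth_on U g" "open U"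
  obtains g1 g2 g3 where "smooth_on U g1" "smooth_on U g2" "smooth_on U g3"
    "\<And>p. p \<in> U \<Longrightarrow> (g has_derivative
        (\<lambda>v. fst (fst v) * g1 p + snd (fst v) * g2 p + snd v * g3 p)) (at p)"
proof -
  from assms(1) obtain dg where cg: "continuous_on U g"
    and dg: "\<And>i. i \<in> Basis \<Longrightarrow> \<forall>x\<in>U. ((\<lambda>s. g (x + s *\<^sub>R i)) has_real_derivative dg i x) (at 0)"
    and sm: "\<And>i. i \<in> Basis \<Longrightarrow> smooth_on U (dg i)"
    by (cases rule: smooth_on.cases) auto
  have B: "((1,0),0) \<in> (Basis :: ((real \<times> real) \<times> real) set)" "((0,1),0) \<in> (Basis :: ((real \<times> real) \<times> real) set)"
    "((0,0),1) \<in> (Basis :: ((real \<times> real) \<times> real) set)"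
    by (auto simp: Basis_prod_def zero_prod_def)
  have smc: "continuous_on U w" if "smooth_on U w" for w :: "(real \<times> real) \<times> real \<Rightarrow> real"
    using that by (cases rule: smooth_on.cases) auto
  let ?g1 = "dg ((1,0),0)" and ?g2 = "dg ((0,1),0)" and ?g3 = "dg ((0,0),1)"
  show ?thesis
  proof (rule that[OF sm[OF B(1)] sm[OF B(2)] sm[OF B(3)]])
    fix p assume p: "p \<in> U"
    obtain x y z where pe: "p = ((x,y),z)" by (metis surj_pair)
    define U' where "U' = (\<lambda>q. (q, z)) -` U"
    have "open U'" unfolding U'_def
      by (intro open_vimage assms continuous_intros)
    have in': "(x,y) \<in> U'" using p pe U'_def by simp
    have e2: "((\<lambda>q. g (q, z)) has_derivative (\<lambda>v. fst v * ?g1 p + snd v * ?g2 p)) (at (x,y))"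
    proof -
      have "((\<lambda>s. g (((x,y),z) + s *\<^sub>R ((1,0),0))) has_real_derivative ?g1 p) (at 0)"
        using dg[OF B(1)] p pe by auto
      then have "((\<lambda>s. g ((x + s,y),z)) has_real_derivative ?g1 p) (at 0)" by simp
      then have 1: "((\<lambda>s. g ((s,y),z)) has_derivative (\<lambda>v. v * ?g1 p)) (at x)"
        using DERIV_shift[of "\<lambda>s. g ((s,y),z)" "?g1 p" 0 x]
        by (simp add: add.commute has_field_derivative_def mult.commute[of _ "?g1 p"])
      have "((\<lambda>q. g (q, z)) has_derivative (\<lambda>v. (\<lambda>v. v * ?g1 p) (fst v) + snd v * (\<lambda>q. ?g2 (q, z)) (x,y))) (at (x,y))"
      proof (rule has_derivative_Pair_partials[OF \<open>open U'\<close> in'])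
        show "((\<lambda>xa. g ((xa, snd (x, y)), z)) has_derivative (\<lambda>v. v * ?g1 p)) (at (fst (x, y)))"
          using 1 by simp
        show "continuous_on U' (\<lambda>q. ?g2 (q, z))"
          by (rule continuous_on_compose2[OF smc[OF sm[OF B(2)]]])
            (auto simp: U'_def intro!: continuous_intros)
        fix q assume "q \<in> U'"
        then have "((\<lambda>s. g ((q,z) + s *\<^sub>R ((0,1),0))) has_real_derivative ?g2 (q,z)) (at 0)"
          using dg[OF B(2)] by (auto simp: U'_def)
        then show "((\<lambda>s. g ((fst q, snd q + s), z)) has_real_derivative ?g2 (q, z)) (at 0)"
          by (cases q) simp
      qed
      then show ?thesis using pe by simp
    qed
    have "(g has_derivative (\<lambda>v. (\<lambda>v. fst v * ?g1 p + snd v * ?g2 p) (fst v) + snd v * ?g3 p)) (at p)"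
    proof (rule has_derivative_Pair_partials[OF \<open>open U\<close> p _ _ smc[OF sm[OF B(3)]]])
      show "((\<lambda>x. g (x, snd p)) has_derivative (\<lambda>v. fst v * ?g1 p + snd v * ?g2 p)) (at (fst p))"
        using e2 by (simp add: pe)
      fix q assume "q \<in> U"
      then have "((\<lambda>s. g (q + s *\<^sub>R ((0,0),1))) has_real_derivative ?g3 q) (at 0)"
        using dg[OF B(3)] by auto
      then show "((\<lambda>s. g (fst q, snd q + s)) has_real_derivative ?g3 q) (at 0)"
        by (cases q) (auto simp flip: zero_prod_def)
    qed
    then show "(g has_derivative (\<lambda>v. fst (fst v) * ?g1 p + snd (fst v) * ?g2 p + snd v * ?g3 p)) (at p)"
      by simp
  qed
qed

section \<open>The upper hemisphere as the graph of \<open>rho\<close> over the unit disc\<close>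

definition rho :: "real \<times> real \<Rightarrow> real" where
  "rho x = sqrt (1 - (norm x)\<^sup>2)"

lemma norm_pair_sq: "(norm (x :: real \<times> real))\<^sup>2 = (fst x)\<^sup>2 + (snd x)\<^sup>2"
  by (cases x) (simp add: norm_Pair)

lemma rho_pos: "norm x < 1 \<Longrightarrow> rho x > 0"
  using abs_square_less_1[of "norm x"] by (simp add: rho_def)

lemma rho_has_derivative:
  assumes "norm x < 1"
  shows "(rho has_derivative (\<lambda>v. fst v * (- fst x * (1 / rho x)) + snd v * (- snd x * (1 / rho x)))) (at x)"
proof -
  have p: "1 - ((fst x)\<^sup>2 + (snd x)\<^sup>2) > 0"
    using assms abs_square_less_1[of "norm x"] by (simp flip: norm_pair_sq)
  have r: "rho = (\<lambda>x. sqrt (1 - ((fst x)\<^sup>2 + (snd x)\<^sup>2)))" by (simp add: rho_def norm_pair_sq fun_eq_iff)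
  have q: "((\<lambda>x. 1 - ((fst x)\<^sup>2 + (snd x)\<^sup>2)) has_derivative
      (\<lambda>v. - (2 * fst x * fst v + 2 * snd x * snd v))) (at x)"
    by (auto intro!: derivative_eq_intros simp: algebra_simps)
  have "rho x > 0" using rho_pos[OF assms] .
  then show ?thesis
    using DERIV_compose_FDERIV[OF DERIV_real_sqrt[OF p] q] unfolding r
    by (rule_tac has_derivative_eq_rhs) (auto simp: field_simps fun_eq_iff)
qed

text \<open>The derivative is again a product of coordinates and factors \<open>1 / rho x\<close>.
  This closed form lets \<open>Ck_inverse_rho\<close> be proved by induction with
  \<open>Ck_mult\<close> alone, and \<open>Ck_rho\<close> then follows from it.\<close>

lemma inverse_rho_has_derivative:
  assumes "norm x < 1"
  shows "((\<lambda>x. 1 / rho x) has_derivative (\<lambda>v. fst v * (fst x * ((1 / rho x) * ((1 / rho x) * (1 / rho x))))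
     + snd v * (snd x * ((1 / rho x) * ((1 / rho x) * (1 / rho x)))))) (at x)"
proof -
  have r: "rho x > 0" using rho_pos[OF assms] .
  then have "((\<lambda>r. 1 / r) has_real_derivative - (1 / rho x * (1 / rho x))) (at (rho x))"
    by (auto intro!: derivative_eq_intros simp: field_simps)
  from DERIV_compose_FDERIV[OF this rho_has_derivative[OF assms]] show ?thesis
    by (rule has_derivative_eq_rhs) (use r in \<open>auto simp: field_simps fun_eq_iff\<close>)
qed

lemma Ck_inverse_rho: "Ck k (ball 0 1) (\<lambda>x. 1 / rho x)"
proof (induction k)
  case 0
  show ?case
    by (auto intro!: continuous_at_imp_continuous_on has_derivative_continuous[OF inverse_rho_has_derivative])
next
  case (Suc k)
  show ?case
    proof (rule Ck_SucI[OF inverse_rho_has_derivative])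
    show "Ck k (ball 0 1) (\<lambda>x. fst x * (1 / rho x * (1 / rho x * (1 / rho x))))"
      "Ck k (ball 0 1) (\<lambda>x. snd x * (1 / rho x * (1 / rho x * (1 / rho x))))"
      by (intro Ck_mult Ck_fst Ck_snd Suc)+
  qed simp
qed

lemma Ck_rho: "Ck k (ball 0 1) rho"
proof (cases k)
  case 0
  then show ?thesis
    by (auto intro!: continuous_at_imp_continuous_on has_derivative_continuous[OF rho_has_derivative])
next
  case (Suc j)
  have m: "Ck j (ball 0 1) (\<lambda>x. - fst x)" "Ck j (ball 0 1) (\<lambda>x. - snd x)"
    using Ck_mult[OF Ck_const[of j _ "-1"] Ck_fst] Ck_mult[OF Ck_const[of j _ "-1"] Ck_snd] by auto
  show ?thesis unfolding Suc
    proof (rule Ck_SucI[OF rho_has_derivative])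
    show "Ck j (ball 0 1) (\<lambda>x. - fst x * (1 / rho x))" "Ck j (ball 0 1) (\<lambda>x. - snd x * (1 / rho x))"
      by (intro Ck_mult m Ck_inverse_rho)+
  qed simp
qed

text \<open>By the chain rule the partial derivatives of the composite are sums of products of
  functions of the same form, with the smooth partials of \<open>g\<close> in place of
  \<open>g\<close>, and derivatives of \<open>rho\<close>. Hence the induction over \<open>k\<close>
  for arbitrary \<open>g\<close>.\<close>

lemma Ck_smooth_graph:
  assumes "open U" "\<And>x. norm x < 1 \<Longrightarrow> (x, rho x) \<in> U" "smooth_on U g"
  shows "Ck k (ball 0 1) (\<lambda>x. g (x, rho x))"
  using assms(3)
proof (induction k arbitrary: g)
  case 0
  then have "continuous_on U g" by (cases rule: smooth_on.cases) auto
  then show ?case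
    using assms(2) Ck_continuous_on[OF Ck_rho[of 0]]
    by (auto intro!: continuous_on_compose2[of U g] continuous_intros)
next
  case (Suc k)
  obtain g1 g2 g3 where g: "smooth_on U g1" "smooth_on U g2" "smooth_on U g3"
    "\<And>p. p \<in> U \<Longrightarrow> (g has_derivative
        (\<lambda>v. fst (fst v) * g1 p + snd (fst v) * g2 p + snd v * g3 p)) (at p)"
    by (rule smooth_on_has_derivative[OF Suc.prems assms(1)]) (rule that)
  have m: "Ck k (ball 0 1) (\<lambda>x. - fst x)" "Ck k (ball 0 1) (\<lambda>x. - snd x)"
    using Ck_mult[OF Ck_const[of k _ "-1"] Ck_fst] Ck_mult[OF Ck_const[of k _ "-1"] Ck_snd] by auto
  show ?case
  proof (rule Ck_SucI)
    fix x :: "real \<times> real" assume "x \<in> ball 0 1"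
    then have x: "norm x < 1" by simp
    have "((\<lambda>x. (x, rho x)) has_derivative (\<lambda>v. (v, fst v * (- fst x * (1 / rho x)) + snd v * (- snd x * (1 / rho x))))) (at x)"
      by (intro has_derivative_Pair rho_has_derivative x has_derivative_ident)
    from has_derivative_compose[OF this g(4)[OF assms(2)[OF x]]]
    show "((\<lambda>x. g (x, rho x)) has_derivative (\<lambda>v. fst v * (g1 (x, rho x) + g3 (x, rho x) * (- fst x * (1 / rho x)))
       + snd v * (g2 (x, rho x) + g3 (x, rho x) * (- snd x * (1 / rho x))))) (at x)"
      by (rule has_derivative_eq_rhs) (auto simp: algebra_simps)
  qed (intro Ck_add Ck_mult Suc.IH g m Ck_inverse_rho)+
qed

text \<open>Dividing by the height \<open>rho\<close> is singular only at the rim of the disc, and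
  there \<open>f\<close> is zero because it vanishes near the equator. Extension by zero therefore
  keeps the differentiability, and evenness carries the formula from the upper to the lower
  hemisphere.\<close>

lemma Ctilde_e_planar_density:
  assumes "f \<in> Ctilde_e"
  obtains h where "Ck k UNIV h" "\<And>x. norm x \<ge> 1 \<Longrightarrow> h x = 0"
    "\<And>x' x3. (x', x3) \<in> sphere 0 1 \<Longrightarrow> f (x', x3) = \<bar>x3\<bar> * h x'"
proof -
  obtain U g where U: "open U" "sphere 0 1 \<subseteq> U" "smooth_on U g" "\<And>x. x \<in> sphere 0 1 \<Longrightarrow> f x = g x"
    using assms unfolding Ctilde_e_def smooth_on_S2_def by auto
  have even: "f (x', - x3) = f (x', x3)" if "(x', x3) \<in> sphere 0 1" for x' x3
    using assms that unfolding Ctilde_e_def by blast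
  obtain e where e: "e > 0" "\<And>x' x3. (x', x3) \<in> sphere 0 1 \<Longrightarrow> \<bar>x3\<bar> < e \<Longrightarrow> f (x', x3) = 0"
    using assms unfolding Ctilde_e_def by blast
  have sph: "(x', x3) \<in> sphere 0 1 \<longleftrightarrow> (norm x')\<^sup>2 + x3\<^sup>2 = 1" for x' :: "real \<times> real" and x3 :: real
    by (auto simp: norm_Pair)
  have on: "(x, rho x) \<in> sphere 0 1" if "norm x < 1" for x
    using that abs_square_less_1[of "norm x"] unfolding sph rho_def by simp
  define u where "u = (\<lambda>x. g (x, rho x) * (1 / rho x))"
  define h where "h = (\<lambda>x. if norm x < 1 then u x else 0)"
  have c: "Ck k (ball 0 1) u" unfolding u_def
    by (intro Ck_mult Ck_inverse_rho Ck_smooth_graph[OF U(1) _ U(3)]) (use on U in auto)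
  define e' where "e' = min e 1"
  have e': "0 < e'" "e' \<le> 1" "e' \<le> e" using e by (auto simp: e'_def)
  \<comment> \<open>In the open disc, points of norm greater than \<open>a\<close> lie under points
    of height below \<open>e'\<close>, where \<open>f\<close> vanishes.\<close>
  define a where "a = sqrt (1 - e'\<^sup>2)"
  have a: "a < 1" using e' by (simp add: a_def)
  have z: "u x = 0" if "a < norm x" "norm x < 1" for x
  proof -
    have "1 - e'\<^sup>2 < (norm x)\<^sup>2" using that(1) unfolding a_def by (meson not_le real_le_rsqrt)
    then have "rho x < sqrt (e'\<^sup>2)" unfolding rho_def by (intro real_sqrt_less_mono) simp
    then have "\<bar>rho x\<bar> < e" using e' rho_pos[OF that(2)] by simp
    then show ?thesis using e(2)[OF on[OF that(2)]] U(4)[OF on[OF that(2)]] by (simp add: u_def)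
  qed
  show ?thesis
  proof (rule that[of h])
    show "Ck k UNIV h" unfolding h_def by (rule Ck_extend_zero[OF a c z])
    show "h x = 0" if "norm x \<ge> 1" for x using that by (simp add: h_def)
    fix x' :: "real \<times> real" and x3 :: real assume s: "(x', x3) \<in> sphere 0 1"
    then have s': "(norm x')\<^sup>2 + x3\<^sup>2 = 1" unfolding sph .
    show "f (x', x3) = \<bar>x3\<bar> * h x'"
    proof (cases "x3 = 0")
      case True
      then show ?thesis using e s by simp
    next
      case False
      then have n: "norm x' < 1" using s' abs_square_less_1[of "norm x'"]
        by (smt (verit) norm_ge_zero zero_less_power2)
      have "1 - (norm x')\<^sup>2 = x3\<^sup>2" using s' by simp
      then have r: "rho x' = \<bar>x3\<bar>" by (simp add: rho_def)
      have "f (x', x3) = f (x', \<bar>x3\<bar>)" using even[OF s] by (simp add: abs_if)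
      then show ?thesis using U(4)[OF on[OF n]] n False by (simp add: h_def u_def r)
    qed
  qed
qed

section \<open>The vertical slice transform as a Radon transform\<close>

definition perp :: "real \<times> real \<Rightarrow> real \<times> real" where
  "perp v = (- snd v, fst v)"

lemma continuous_on_circ [continuous_intros]:
  fixes g :: "'a::t2_space \<Rightarrow> real"
  shows "continuous_on A g \<Longrightarrow> continuous_on A (\<lambda>x. circ (g x))"
  unfolding circ_def by (intro continuous_intros)

lemma continuous_on_perp [continuous_intros]:
  "continuous_on A g \<Longrightarrow> continuous_on A (\<lambda>x. perp (g x))"
  unfolding perp_def by (intro continuous_intros)

lemma norm_circ_perp:
  "norm (t *\<^sub>R circ \<alpha> + s *\<^sub>R perp (circ \<alpha>)) = sqrt (t\<^sup>2 + s\<^sup>2)"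
proof -
  have "(t * cos \<alpha> + s * - sin \<alpha>)\<^sup>2 + (t * sin \<alpha> + s * cos \<alpha>)\<^sup>2
      = (t\<^sup>2 + s\<^sup>2) * ((sin \<alpha>)\<^sup>2 + (cos \<alpha>)\<^sup>2)"
    by algebra
  then show ?thesis by (simp add: circ_def perp_def norm_Pair)
qed

lemma norm_circ [simp]: "norm (circ \<alpha>) = 1"
  using norm_circ_perp[of 1 \<alpha> 0] by simp

lemma circ_add_pi: "circ (\<alpha> + pi) = - circ \<alpha>"
  by (simp add: circ_def)

lemma circ_add_2pi: "circ (\<alpha> + 2 * pi) = circ \<alpha>"
  by (simp add: circ_def)

lemma orthonormal_expansion:
  "y = (circ \<alpha> \<bullet> y) *\<^sub>R circ \<alpha> + (perp (circ \<alpha>) \<bullet> y) *\<^sub>R perp (circ \<alpha>)"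
proof -
  obtain a b where y: "y = (a, b)" by (cases y)
  have "x = x * (cos \<alpha> * cos \<alpha>) + x * (sin \<alpha> * sin \<alpha>)" for x
    by (metis sin_cos_squared_add3 distrib_left mult.right_neutral)
  then show ?thesis
    by (simp add: y circ_def perp_def algebra_simps)
qed

text \<open>The vector on the left has length \<open>sqrt (1 + u\<^sup>2)\<close> and encloses the
  angle \<open>arctan u\<close> with \<open>circ \<alpha>\<close>. For fixed \<open>u\<close>,
  changing the slope thus becomes a rotation and a dilation, both harmless for means over
  circles.\<close>

lemma circ_rotate_arctan:
  "circ \<alpha> + u *\<^sub>R perp (circ \<alpha>) = sqrt (1 + u\<^sup>2) *\<^sub>R circ (\<alpha> + arctan u)"
proof -
  have "sqrt (1 + u\<^sup>2) > 0" by (simp add: add_pos_nonneg)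
  then show ?thesis
    by (simp add: circ_def perp_def cos_add sin_add cos_arctan sin_arctan field_simps)
qed

lemma arc_integral_circ: "arc_integral circ 0 (2 * pi) u = (LBINT \<alpha>=0..2 * pi. u (circ \<alpha>))"
proof -
  have "vector_derivative circ (at \<alpha>) = perp (circ \<alpha>)" for \<alpha>
    unfolding circ_def perp_def
    by (rule vector_derivative_at) (auto intro!: derivative_eq_intros has_vector_derivative_Pair
        simp flip: has_real_derivative_iff_has_vector_derivative)
  moreover have "norm (perp (circ \<alpha>)) = 1" for \<alpha> using norm_circ_perp[of 0 \<alpha> 1] by simp
  ultimately show ?thesis unfolding arc_integral_def by (simp add: zero_ereal_def)
qed

text \<open>A bridge between two integrals: Fubini and affine substitutions are done for
  \<open>lborel\<close>, the fundamental theorem and differentiation under the integral for the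
  gauge integral on an interval.\<close>

lemma LBINT_eq_integral_of_support:
  fixes F :: "real \<Rightarrow> real"
  assumes "continuous_on UNIV F" "\<And>x. x \<notin> {a..b} \<Longrightarrow> F x = 0"
  shows "integrable lborel F" "(LINT x|lborel. F x) = integral {a..b} F"
proof -
  have s: "set_integrable lborel {a..b} F"
    by (intro borel_integrable_atLeastAtMost' continuous_on_subset[OF assms(1)]) auto
  have e: "(\<lambda>x. indicator {a..b} x *\<^sub>R F x) = F"
    using assms(2) by (auto simp: indicator_def fun_eq_iff)
  show "integrable lborel F" using s unfolding set_integrable_def e .
  show "(LINT x|lborel. F x) = integral {a..b} F"
    using set_borel_integral_eq_integral(2)[OF s] unfolding set_lebesgue_integral_def e .
qed

lemma LBINT_eq_integral_continuous:
  fixes F :: "real \<Rightarrow> real"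
  assumes "continuous_on UNIV F" "a \<le> b"
  shows "(LBINT x=a..b. F x) = integral {a..b} F"
  by (intro interval_integral_eq_integral assms borel_integrable_atLeastAtMost'
      continuous_on_subset[OF assms(1)]) auto

text \<open>With \<open>s = r * cos \<phi>\<close> the density contributes the height
  \<open>r * \<bar>sin \<phi>\<bar>\<close>, which is exactly the size of \<open>ds/d\<phi>\<close>,
  and arc length contributes one more factor \<open>r\<close>. The upper and the lower half circle
  each traverse the chord once, whence the factor 2.\<close>

lemma vertical_slice_eq_line_integral:
  assumes h: "continuous_on UNIV h" "\<And>x. norm x \<ge> 1 \<Longrightarrow> h x = 0"
    and f: "\<And>x' x3. (x', x3) \<in> sphere 0 1 \<Longrightarrow> f (x', x3) = \<bar>x3\<bar> * h x'"
    and t: "\<bar>t\<bar> < 1"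
  shows "V f (circ \<alpha>) t = 2 * sqrt (1 - t\<^sup>2) *
    (LINT s|lborel. h (t *\<^sub>R circ \<alpha> + s *\<^sub>R perp (circ \<alpha>)))"
proof -
  define r where "r = sqrt (1 - t\<^sup>2)"
  have t2: "t\<^sup>2 < 1" using t by (simp add: abs_square_less_1)
  have r: "r > 0" "r\<^sup>2 = 1 - t\<^sup>2" using t2 by (auto simp: r_def)
  define H where "H = (\<lambda>s. h (t *\<^sub>R circ \<alpha> + s *\<^sub>R perp (circ \<alpha>)))"
  have H: "continuous_on UNIV H" unfolding H_def
    by (intro continuous_on_compose2[OF h(1)] continuous_intros) auto
  have H0: "H s = 0" if "s \<notin> {-r..r}" for s
  proof -
    have "r\<^sup>2 \<le> s\<^sup>2" using that r(1) by (intro abs_le_square_iff[THEN iffD1]) auto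
    then show ?thesis unfolding H_def
      using r(2) by (intro h(2)) (simp add: norm_circ_perp)
  qed
  have sl: "slice_circ (circ \<alpha>) t \<phi>
      = (t *\<^sub>R circ \<alpha> + (r * cos \<phi>) *\<^sub>R perp (circ \<alpha>), r * sin \<phi>)" for \<phi>
    by (simp add: slice_circ_def r_def perp_def Let_def)
  have dsl: "vector_derivative (slice_circ (circ \<alpha>) t) (at \<phi>)
      = ((- r * sin \<phi>) *\<^sub>R perp (circ \<alpha>), r * cos \<phi>)" for \<phi>
  proof (rule vector_derivative_at)
    have "((\<lambda>\<phi>. (t *\<^sub>R circ \<alpha> + (r * cos \<phi>) *\<^sub>R perp (circ \<alpha>), r * sin \<phi>)) has_vector_derivative
        ((- r * sin \<phi>) *\<^sub>R perp (circ \<alpha>), r * cos \<phi>)) (at \<phi>)"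
      by (rule has_vector_derivative_Pair)
        (auto intro!: derivative_eq_intros simp flip: has_real_derivative_iff_has_vector_derivative)
    then show "(slice_circ (circ \<alpha>) t has_vector_derivative
        ((- r * sin \<phi>) *\<^sub>R perp (circ \<alpha>), r * cos \<phi>)) (at \<phi>)"
      unfolding sl[abs_def, symmetric] by (simp add: sl)
  qed
  have n: "norm (vector_derivative (slice_circ (circ \<alpha>) t) (at \<phi>)) = r" for \<phi>
  proof -
    have "norm (perp (circ \<alpha>)) = 1" using norm_circ_perp[of 0 \<alpha> 1] by simp
    then have "norm (vector_derivative (slice_circ (circ \<alpha>) t) (at \<phi>))
       = sqrt (r\<^sup>2 * ((sin \<phi>)\<^sup>2 + (cos \<phi>)\<^sup>2))"
      unfolding dsl norm_Pair by (simp add: power_mult_distrib distrib_left del: sin_cos_squared_add)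
    then show ?thesis using r(1) by simp
  qed
  have fs: "f (slice_circ (circ \<alpha>) t \<phi>) = r * \<bar>sin \<phi>\<bar> * H (r * cos \<phi>)" for \<phi>
  proof -
    have "slice_circ (circ \<alpha>) t \<phi> \<in> sphere 0 1"
    proof -
      have "(norm (slice_circ (circ \<alpha>) t \<phi>))\<^sup>2 = t\<^sup>2 + r\<^sup>2 * ((sin \<phi>)\<^sup>2 + (cos \<phi>)\<^sup>2)"
        unfolding sl norm_Pair norm_circ_perp
        by (simp add: power_mult_distrib distrib_left del: sin_cos_squared_add)
      then have "(norm (slice_circ (circ \<alpha>) t \<phi>))\<^sup>2 = 1" using r by simp
      then show ?thesis by (simp add: abs_square_eq_1)
    qed
    then show ?thesis unfolding sl using r by (subst f) (auto simp: H_def abs_mult)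
  qed
  have rc: "r * cos \<phi> \<in> {-r..r}" for \<phi>
  proof -
    have "\<bar>r * cos \<phi>\<bar> \<le> r" using r by (simp add: abs_mult mult_left_le)
    then show ?thesis by auto
  qed
  define FF where "FF = (\<lambda>\<phi>. r * \<bar>sin \<phi>\<bar> * H (r * cos \<phi>) * r)"
  have cFF: "continuous_on A FF" for A unfolding FF_def
    by (intro continuous_intros continuous_on_compose2[OF H]) auto
  have "V f (circ \<alpha>) t = (LBINT \<phi>=0..2 * pi. FF \<phi>)"
    unfolding V_def arc_integral_def n fs FF_def by (simp add: zero_ereal_def)
  also have "\<dots> = integral {0..2 * pi} FF"
    using LBINT_eq_integral_continuous[of FF 0 "2*pi"] cFF by (simp add: zero_ereal_def)
  \<comment> \<open>The split at \<open>pi\<close> is where \<open>sin\<close> changes sign. On the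
    first half \<open>r * cos \<phi>\<close> decreases from \<open>r\<close> to \<open>-r\<close>,
    on the second it increases back; the substitution rule returns a difference of two integrals,
    one of which is over an empty interval.\<close>
  also have "\<dots> = integral {0..pi} FF + integral {pi..2 * pi} FF"
    by (intro Henstock_Kurzweil_Integration.integral_combine[symmetric] integrable_continuous_interval cFF) auto
  also have "integral {0..pi} FF = r * integral {-r..r} H"
  proof -
    have "((\<lambda>\<phi>. (- r * sin \<phi>) *\<^sub>R H (r * cos \<phi>)) has_integral
       (integral {r * cos 0..r * cos pi} H - integral {r * cos pi..r * cos 0} H)) {0..pi}"
      by (rule has_integral_substitution_general[of "{}" _ _ _ "-r" r])
        (use rc in \<open>auto intro!: continuous_intros derivative_eq_intros continuous_on_subset[OF H]\<close>)
    then have "((\<lambda>\<phi>. (- r * sin \<phi>) *\<^sub>R H (r * cos \<phi>)) has_integral (- integral {-r..r} H)) {0..pi}"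
      using r by simp
    from has_integral_mult_right[OF this, of "-r"]
    have "((\<lambda>\<phi>. - r * ((- r * sin \<phi>) *\<^sub>R H (r * cos \<phi>))) has_integral (r * integral {-r..r} H)) {0..pi}" by simp
    then have "(FF has_integral (r * integral {-r..r} H)) {0..pi}"
      by (rule has_integral_eq[rotated]) (use sin_ge_zero in \<open>auto simp: FF_def\<close>)
    then show ?thesis by (rule integral_unique)
  qed
  also have "integral {pi..2 * pi} FF = r * integral {-r..r} H"
  proof -
    have "((\<lambda>\<phi>. (- r * sin \<phi>) *\<^sub>R H (r * cos \<phi>)) has_integral
       (integral {r * cos pi..r * cos (2 * pi)} H - integral {r * cos (2 * pi)..r * cos pi} H)) {pi..2*pi}"
      by (rule has_integral_substitution_general[of "{}" _ _ _ "-r" r])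
        (use rc in \<open>auto intro!: continuous_intros derivative_eq_intros continuous_on_subset[OF H]\<close>)
    then have "((\<lambda>\<phi>. (- r * sin \<phi>) *\<^sub>R H (r * cos \<phi>)) has_integral (integral {-r..r} H)) {pi..2*pi}"
      using r by simp
    from has_integral_mult_right[OF this, of r]
    have "((\<lambda>\<phi>. r * ((- r * sin \<phi>) *\<^sub>R H (r * cos \<phi>))) has_integral (r * integral {-r..r} H)) {pi..2*pi}" .
    then have "(FF has_integral (r * integral {-r..r} H)) {pi..2*pi}"
      by (rule has_integral_eq[rotated]) (use sin_le_zero in \<open>force simp: FF_def\<close>)
    then show ?thesis by (rule integral_unique)
  qed
  also have "integral {-r..r} H = (LINT s|lborel. H s)"
    using LBINT_eq_integral_of_support(2)[OF H H0] by simp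
  finally show ?thesis by (simp add: H_def r_def)
qed

text \<open>The factor \<open>sqrt (1 - t\<^sup>2)\<close> of the line integral cancels the weight,
  and the line integral vanishes for \<open>\<bar>t\<bar> \<ge> 1\<close>, so \<open>t\<close> may
  range over the whole line. Translations in \<open>t\<close> and \<open>s\<close> move the origin
  to \<open>y\<close>, and \<open>s = t * u\<close> supplies the factor \<open>\<bar>t\<bar>\<close>
  that tames the logarithm.\<close>

lemma slice_log_integral:
  assumes h: "continuous_on UNIV h" "\<And>x. norm x \<ge> 1 \<Longrightarrow> h x = 0"
    and f: "\<And>x' x3. (x', x3) \<in> sphere 0 1 \<Longrightarrow> f (x', x3) = \<bar>x3\<bar> * h x'"
  shows "(LBINT t=-1..1. V f (circ \<alpha>) t * ln \<bar>t - circ \<alpha> \<bullet> y\<bar> / sqrt (1 - t\<^sup>2))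
    = 2 * (LINT t|lborel. LINT u|lborel.
        \<bar>t\<bar> * ln \<bar>t\<bar> * h (y + t *\<^sub>R (circ \<alpha> + u *\<^sub>R perp (circ \<alpha>))))"
proof -
  let ?c = "circ \<alpha>" and ?p = "perp (circ \<alpha>)"
  define W where "W = (\<lambda>t. LINT s|lborel. h (t *\<^sub>R ?c + s *\<^sub>R ?p))"
  have W0: "W t = 0" if "\<not> \<bar>t\<bar> < 1" for t
  proof -
    have "h (t *\<^sub>R ?c + s *\<^sub>R ?p) = 0" for s
    proof (rule h(2))
      have "1 \<le> t\<^sup>2" using that abs_square_less_1[of t] by simp
      then have "1 \<le> t\<^sup>2 + s\<^sup>2" by (simp add: add_increasing2)
      then show "1 \<le> norm (t *\<^sub>R ?c + s *\<^sub>R ?p)" by (simp add: norm_circ_perp)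
    qed
    then show ?thesis by (simp add: W_def)
  qed
  have e: "(-1 :: ereal) = ereal (-1)" "(1::ereal) = ereal 1" by (simp_all add: one_ereal_def)
  have "(LBINT t=-1..1. V f ?c t * ln \<bar>t - ?c \<bullet> y\<bar> / sqrt (1 - t\<^sup>2))
     = (LINT t|lborel. indicator {-1<..<1} t *\<^sub>R (V f ?c t * ln \<bar>t - ?c \<bullet> y\<bar> / sqrt (1 - t\<^sup>2)))"
    unfolding e by (subst interval_lebesgue_integral_le_eq) (auto simp: set_lebesgue_integral_def)
  also have "\<dots> = (LINT t|lborel. 2 * (ln \<bar>t - ?c \<bullet> y\<bar> * W t))"
  proof (intro Bochner_Integration.integral_cong refl)
    fix t :: real
    show "indicator {-1<..<1} t *\<^sub>R (V f ?c t * ln \<bar>t - ?c \<bullet> y\<bar> / sqrt (1 - t\<^sup>2)) = 2 * (ln \<bar>t - ?c \<bullet> y\<bar> * W t)"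
    proof (cases "\<bar>t\<bar> < 1")
      case True
      then have "indicator {-1<..<1} t = (1::real)" by (auto simp: indicator_def)
      moreover have "1 - t\<^sup>2 > 0" using True abs_square_less_1[of t] by simp
      ultimately show ?thesis
        using vertical_slice_eq_line_integral[OF h f True, of \<alpha>] True by (simp add: W_def)
    next
      case False
      then have "t \<notin> {-1<..<1}" by auto
      then show ?thesis using W0[OF False] by simp
    qed
  qed
  also have "\<dots> = 2 * (LINT t|lborel. ln \<bar>t - ?c \<bullet> y\<bar> * W t)" by simp
  also have "(LINT t|lborel. ln \<bar>t - ?c \<bullet> y\<bar> * W t) = (LINT t|lborel. ln \<bar>t\<bar> * W (?c \<bullet> y + t))"
    by (subst lborel_integral_real_affine[where t="?c \<bullet> y" and c=1]) simp_all
  also have "\<dots> = (LINT t|lborel. LINT u|lborel. \<bar>t\<bar> * ln \<bar>t\<bar> * h (y + t *\<^sub>R (?c + u *\<^sub>R ?p)))"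
  proof (intro Bochner_Integration.integral_cong refl)
    fix t :: real
    \<comment> \<open>The shifts of \<open>t\<close> and \<open>s\<close> are the coordinates of
      \<open>y\<close> in the rotated frame, so together they add up to \<open>y\<close>.\<close>
    have "(?c \<bullet> y + t) *\<^sub>R ?c + (?p \<bullet> y + s) *\<^sub>R ?p = y + t *\<^sub>R ?c + s *\<^sub>R ?p" for s
      using orthonormal_expansion[of y \<alpha>] by (simp add: algebra_simps)
    moreover have "W (?c \<bullet> y + t) = (LINT s|lborel. h ((?c \<bullet> y + t) *\<^sub>R ?c + (?p \<bullet> y + s) *\<^sub>R ?p))"
      unfolding W_def by (subst lborel_integral_real_affine[where t="?p \<bullet> y" and c=1]) simp_all
    ultimately have W: "W (?c \<bullet> y + t) = (LINT s|lborel. h (y + t *\<^sub>R ?c + s *\<^sub>R ?p))" by simp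
    txt \<open>At \<^term>\<open>t = 0\<close> both sides vanish because of \<^prop>\<open>ln (0::real) = 0\<close>.\<close>
    show "ln \<bar>t\<bar> * W (?c \<bullet> y + t) = (LINT u|lborel. \<bar>t\<bar> * ln \<bar>t\<bar> * h (y + t *\<^sub>R (?c + u *\<^sub>R ?p)))"
    proof (cases "t = 0")
      case False
      then have "W (?c \<bullet> y + t) = \<bar>t\<bar> * (LINT u|lborel. h (y + t *\<^sub>R ?c + (t * u) *\<^sub>R ?p))"
        unfolding W by (subst lborel_integral_real_affine[where t=0 and c=t]) simp_all
      then show ?thesis by (simp add: algebra_simps)
    qed simp
  qed
  finally show ?thesis .
qed

section \<open>Circular means and the logarithmic kernel\<close>

text \<open>Only the origin needs an argument: both one-sided limits there are 0. This continuity is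
  what makes the final kernel nonsingular.\<close>

lemma continuous_on_abs_ln_abs: "continuous_on UNIV (\<lambda>x::real. \<bar>x\<bar> * ln \<bar>x\<bar>)"
proof (intro continuous_at_imp_continuous_on ballI)
  fix x :: real
  show "isCont (\<lambda>x. \<bar>x\<bar> * ln \<bar>x\<bar>) x"
  proof (cases "x = 0")
    case True
    have "((\<lambda>x::real. \<bar>x\<bar> * ln \<bar>x\<bar>) \<longlongrightarrow> 0) (at_right 0)" by real_asymp
    moreover have "((\<lambda>x::real. \<bar>x\<bar> * ln \<bar>x\<bar>) \<longlongrightarrow> 0) (at_left 0)" by real_asymp
    ultimately have "((\<lambda>x::real. \<bar>x\<bar> * ln \<bar>x\<bar>) \<longlongrightarrow> 0) (at 0)"
      by (simp add: filterlim_at_split)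
    then show ?thesis by (simp add: True isCont_def)
  next
    case False
    then show ?thesis by (intro continuous_intros) auto
  qed
qed

text \<open>The antiderivative \<open>t * ln t - t\<close> is continuous up to 0, which gives
  integrability of \<open>ln\<close> on \<open>{0..a}\<close>; absolute integrability and reflection
  do the rest. It supplies the majorant for Fubini.\<close>

lemma integrable_ln_abs:
  assumes "a > 0"
  shows "integrable lborel (\<lambda>t::real. indicator {-a..a} t * \<bar>ln \<bar>t\<bar>\<bar>)"
proof -
  have c: "continuous_on {0..a} (\<lambda>t. \<bar>t\<bar> * ln \<bar>t\<bar> - t)"
    by (intro continuous_intros continuous_on_subset[OF continuous_on_abs_ln_abs]) auto
  have c': "continuous_on {0..a} (\<lambda>t. t * ln t - t)"
    using c by (subst continuous_on_cong[OF refl, of _ _ "\<lambda>t. \<bar>t\<bar> * ln \<bar>t\<bar> - t"]) auto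
  have "(ln has_integral (a * ln a - a - (0 * ln 0 - 0))) {0..a}"
  proof (rule fundamental_theorem_of_calculus_interior[OF _ c'])
    fix x assume "x \<in> {0<..<a}"
    then show "((\<lambda>t. t * ln t - t) has_vector_derivative ln x) (at x)"
      by (auto intro!: derivative_eq_intros simp flip: has_real_derivative_iff_has_vector_derivative)
  qed (use assms in auto)
  then have "ln integrable_on {0..a}" by blast
  moreover have "(\<lambda>t::real. t) absolutely_integrable_on {0..a}"
    by (intro absolutely_integrable_continuous_real continuous_intros)
  \<comment> \<open>An integrable function bounded above by an absolutely integrable one is
    absolutely integrable; here the bound is \<open>ln t \<le> t\<close>.\<close>
  ultimately have "ln absolutely_integrable_on {0..a}"
    by (rule absolutely_integrable_absolutely_integrable_ubound) (use ln_bound ln_0 in \<open>force simp: le_less\<close>)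
  then have "(\<lambda>t. \<bar>ln t\<bar>) absolutely_integrable_on {0..a}"
    using set_integrable_abs by blast
  then have "integrable lborel (\<lambda>t. indicator {0..a} t * \<bar>ln t\<bar>)"
    unfolding set_integrable_def by (subst (asm) integrable_completion) auto
  then have "integrable lborel (\<lambda>t. indicator {0..a} t * \<bar>ln \<bar>t\<bar>\<bar>)"
    by (rule Bochner_Integration.integrable_cong[OF refl, THEN iffD1, rotated]) (auto simp: indicator_def)
  \<comment> \<open>Adding the mirror image counts the point 0 twice, which does not matter since
    \<open>ln 0 = 0\<close>.\<close>
  note this lborel_integrable_real_affine[OF this, of "-1" 0]
  from Bochner_Integration.integrable_add[OF this[simplified]]
  show ?thesis
    by (rule Bochner_Integration.integrable_cong[OF refl, THEN iffD1, rotated]) (auto simp: indicator_def)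
qed

section \<open>Integrals over a period and means over circles\<close>

lemma integral_periodic_shift:
  fixes F :: "real \<Rightarrow> real"
  assumes F: "continuous_on UNIV F" and per: "\<And>x. F (x + T) = F x" and c: "\<bar>c\<bar> \<le> T"
  shows "integral {0..T} (\<lambda>x. F (x + c)) = integral {0..T} F"
proof -
  have pos: "integral {0..T} (\<lambda>x. F (x + c)) = integral {0..T} F"
    if F: "continuous_on UNIV F" and per: "\<And>x. F (x + T) = F x" and c: "0 \<le> c" "c \<le> T"
    for F :: "real \<Rightarrow> real" and c
  proof -
    have i: "F integrable_on {a..b}" for a b
      by (intro integrable_continuous_interval continuous_on_subset[OF F]) auto
    have s: "integral {a..b} (\<lambda>x. F (x + d)) = integral {a + d..b + d} F" for a b d
      using integral_shift[of a d b F] continuous_on_subset[OF F] by (auto simp: o_def)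
    have "integral {0..T} (\<lambda>x. F (x + c)) = integral {c..T + c} F"
      using s[of 0 T c] by simp
    also have "\<dots> = integral {c..T} F + integral {T..T + c} F"
      using c by (intro Henstock_Kurzweil_Integration.integral_combine[symmetric] i) auto
    also have "integral {T..T + c} F = integral {0..c} F"
      using s[of 0 c T] by (simp add: per add.commute)
    also have "integral {c..T} F + integral {0..c} F = integral {0..T} F"
      using Henstock_Kurzweil_Integration.integral_combine[of 0 c T F] c i by simp
    finally show ?thesis .
  qed
  show ?thesis
  proof (cases "c \<ge> 0")
    case True
    then show ?thesis using pos[OF F per] c by auto
  next
    case False
    \<comment> \<open>A negative shift is undone by the positive shift \<open>- c\<close> of the
      already shifted function.\<close>
    have "integral {0..T} (\<lambda>x. F (x + - c + c)) = integral {0..T} (\<lambda>x. F (x + c))"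
    proof (rule pos)
      show "continuous_on UNIV (\<lambda>x. F (x + c))"
        by (intro continuous_on_compose2[OF F] continuous_intros) auto
      show "F (x + T + c) = F (x + c)" for x using per[of "x + c"] by (simp add: ac_simps)
    qed (use False c in auto)
    then show ?thesis by simp
  qed
qed

text \<open>An unnormalised mean, with total weight \<open>2 * pi\<close>. The radius
  \<open>w\<close> is signed: \<open>circ_mean_minus\<close> shows evenness, because reflection in
  the centre is rotation by \<open>pi\<close>.\<close>

definition circ_mean :: "(real \<times> real \<Rightarrow> real) \<Rightarrow> real \<times> real \<Rightarrow> real \<Rightarrow> real" where
  "circ_mean h y w = integral {0..2 * pi} (\<lambda>\<alpha>. h (y + w *\<^sub>R circ \<alpha>))"

lemma continuous_on_circ_mean:
  assumes "continuous_on UNIV h"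
  shows "continuous_on UNIV (circ_mean h y)"
proof -
  have "continuous_on UNIV (\<lambda>w. integral (cbox 0 (2*pi)) (\<lambda>\<alpha>. h (y + w *\<^sub>R circ \<alpha>)))"
    by (rule integral_continuous_on_param)
      (auto simp: case_prod_unfold intro!: continuous_on_compose2[OF assms] continuous_intros)
  then show ?thesis by (simp add: circ_mean_def[abs_def])
qed

lemma circ_mean_shift:
  assumes "continuous_on UNIV h" "\<bar>c\<bar> \<le> 2 * pi"
  shows "integral {0..2 * pi} (\<lambda>\<alpha>. h (y + w *\<^sub>R circ (\<alpha> + c))) = circ_mean h y w"
  unfolding circ_mean_def
  by (intro integral_periodic_shift[of "\<lambda>\<alpha>. h (y + w *\<^sub>R circ \<alpha>)"] continuous_on_compose2[OF assms(1)] continuous_intros assms(2))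
    (auto simp: circ_add_2pi)

lemma circ_mean_minus:
  assumes "continuous_on UNIV h"
  shows "circ_mean h y (- w) = circ_mean h y w"
  using circ_mean_shift[OF assms, of pi y w] by (simp add: circ_mean_def circ_add_pi)

lemma circ_mean_eq_0:
  assumes "\<And>x. norm x \<ge> 1 \<Longrightarrow> h x = 0" "1 + norm y \<le> \<bar>w\<bar>"
  shows "circ_mean h y w = 0"
proof -
  have "h (y + w *\<^sub>R circ \<alpha>) = 0" for \<alpha>
  proof (rule assms(1))
    have "\<bar>w\<bar> = norm (w *\<^sub>R circ \<alpha>)" by simp
    also have "\<dots> \<le> norm (y + w *\<^sub>R circ \<alpha>) + norm y"
      using norm_triangle_ineq4[of "y + w *\<^sub>R circ \<alpha>" y] by simp
    finally show "1 \<le> norm (y + w *\<^sub>R circ \<alpha>)" using assms by simp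
  qed
  then show ?thesis by (simp add: circ_mean_def)
qed

text \<open>The value is pi times ln 2. It is left symbolic because its contribution vanishes at
  both end points in \<open>polar_integral_laplacian\<close>.\<close>

definition log_const :: real where
  "log_const = (LINT u|lborel. inverse (1 + u\<^sup>2) * ln (sqrt (1 + u\<^sup>2)))"

text \<open>With \<open>k = sqrt (1 + u\<^sup>2)\<close> this is twice the integral over
  \<open>u\<close> of \<open>\<bar>w / k\<bar> * ln \<bar>w / k\<bar> / k\<close>, evaluated by
  \<open>abs_ln_abs_divide\<close>; the outer 2 comes from the two half circles of a slice.\<close>

definition polar_kernel :: "real \<Rightarrow> real" where
  "polar_kernel w = 2 * (pi * (\<bar>w\<bar> * ln \<bar>w\<bar>) - log_const * \<bar>w\<bar>)"

lemma continuous_on_polar_kernel: "continuous_on UNIV polar_kernel"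
  unfolding polar_kernel_def[abs_def]
  by (intro continuous_intros continuous_on_abs_ln_abs)

lemma LBINT_inverse_1_plus_square_lborel:
  "integrable lborel (\<lambda>u::real. inverse (1 + u\<^sup>2))"
  "(LINT u|lborel. inverse (1 + u\<^sup>2)) = pi"
  using integrable_inverse_1_plus_square LBINT_inverse_1_plus_square
  by (simp_all add: set_integrable_def interval_lebesgue_integral_def set_lebesgue_integral_def)

lemma abs_ln_abs_divide:
  fixes w k :: real
  assumes "k > 0"
  shows "\<bar>w / k\<bar> * ln \<bar>w / k\<bar> = (\<bar>w\<bar> * ln \<bar>w\<bar> - ln k * \<bar>w\<bar>) / k"
  using assms by (cases "w = 0") (auto simp: ln_div field_simps)

text \<open>Fubini moves the slope \<open>u\<close> to the outside. For fixed \<open>u\<close> the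
  integral over the angle is a circular mean by rotation invariance, and rescaling \<open>t\<close>
  separates the dependence on \<open>u\<close> into the integrals giving \<open>pi\<close> and
  \<open>log_const\<close>.\<close>

lemma log_integral_eq_polar:
  fixes f :: "(real \<times> real) \<times> real \<Rightarrow> real"
  assumes h: "continuous_on UNIV h" "\<And>x. norm x \<ge> 1 \<Longrightarrow> h x = 0"
    and f: "\<And>x' x3. (x', x3) \<in> sphere 0 1 \<Longrightarrow> f (x', x3) = \<bar>x3\<bar> * h x'"
    and y: "norm y < 1"
  shows "arc_integral circ 0 (2 * pi) (\<lambda>\<theta>. LBINT t=-1..1. V f \<theta> t * ln \<bar>t - \<theta> \<bullet> y\<bar> / sqrt (1 - t\<^sup>2))
    = integral {-2..2} (\<lambda>w. polar_kernel w * circ_mean h y w)"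
proof -
  define ell where "ell = (\<lambda>t::real. \<bar>t\<bar> * ln \<bar>t\<bar>)"
  have cell: "continuous_on UNIV ell" unfolding ell_def by (rule continuous_on_abs_ln_abs)
  have ell0: "ell 0 = 0" by (simp add: ell_def)
  \<comment> \<open>The pair \<open>p\<close> holds angle and \<open>t\<close>, since Fubini
    exchanges \<open>p\<close> as a whole with \<open>u\<close>. In \<open>Z\<close> the angle is
    cut off by an indicator, while \<open>t\<close> is confined by the support of
    \<open>h\<close>.\<close>
  define P where "P = (\<lambda>p u. y + snd p *\<^sub>R (circ (fst p) + u *\<^sub>R perp (circ (fst p))))"
  define Z where "Z = (\<lambda>p u. indicator {0..2 * pi} (fst p) * (ell (snd p) * h (P p u)))"
  have cP: "continuous_on UNIV (\<lambda>q. h (P (fst q) (snd q)))"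
    unfolding P_def by (intro continuous_on_compose2[OF h(1)] continuous_intros) auto
  have normP: "norm (P (\<alpha>, t) u - y) = sqrt (t\<^sup>2 + (t * u)\<^sup>2)" for \<alpha> t u
    using norm_circ_perp[of t \<alpha> "t * u"] by (simp add: P_def algebra_simps)
  have supp: "h (y + z) = 0" if "2 \<le> norm z" for z
  proof (rule h(2))
    show "1 \<le> norm (y + z)" using norm_triangle_ineq4[of "y + z" y] that y by simp
  qed
  obtain C where C: "\<And>x. \<bar>h x\<bar> \<le> C"
  proof -
    have "compact (h ` cball 0 1)" by (intro compact_continuous_image continuous_on_subset[OF h(1)]) auto
    then have "bounded (h ` cball 0 1)" by (rule compact_imp_bounded)
    then obtain C where C: "\<forall>z\<in>h ` cball 0 1. norm z \<le> C"
      unfolding bounded_iff by blast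
    have "\<bar>h x\<bar> \<le> max C 0" for x
    proof (cases "norm x \<le> 1")
      case True
      then have "norm (h x) \<le> C" by (intro C[rule_format] imageI) simp
      then show ?thesis by simp
    qed (simp add: h(2))
    then show ?thesis by (rule that)
  qed
  have C0: "C \<ge> 0" using C[of 0] by simp
  have mZ: "case_prod Z \<in> borel_measurable (lborel \<Otimes>\<^sub>M lborel)"
  proof -
    have "(\<lambda>q. indicator {0..2 * pi} (fst (fst q)) * (ell (snd (fst q)) * h (P (fst q) (snd q)))) \<in>
        borel_measurable (borel :: ((real \<times> real) \<times> real) measure)"
    proof (intro borel_measurable_times)
      have "closed ((\<lambda>q::(real\<times>real)\<times>real. fst (fst q)) -` {0..2*pi})"
        by (intro closed_vimage continuous_intros)
      then have "(\<lambda>q::(real\<times>real)\<times>real. indicator ((\<lambda>q. fst (fst q)) -` {0..2*pi}) q :: real) \<in> borel_measurable borel"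
        by (intro borel_measurable_indicator borel_closed)
      then show "(\<lambda>q::(real\<times>real)\<times>real. indicator {0..2 * pi} (fst (fst q)) :: real) \<in> borel_measurable borel"
        by (simp add: indicator_def)
      show "(\<lambda>q::(real\<times>real)\<times>real. ell (snd (fst q))) \<in> borel_measurable borel"
        by (intro borel_measurable_continuous_onI continuous_on_compose2[OF cell] continuous_intros) auto
      show "(\<lambda>q. h (P (fst q) (snd q))) \<in> borel_measurable borel"
        by (intro borel_measurable_continuous_onI cP)
    qed
    then show ?thesis by (simp add: lborel_prod Z_def case_prod_unfold)
  qed
  \<comment> \<open>In the coordinates \<open>t\<close>, \<open>s\<close> centred at
    \<open>y\<close> the support of \<open>h\<close> lies in the square of half-width 2; the bound
    is the length 4 of a side times the maximum of \<open>h\<close>.\<close>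
  have line: "integrable lborel (\<lambda>s. h (y + t *\<^sub>R circ \<alpha> + s *\<^sub>R perp (circ \<alpha>)))"
    "(LINT s|lborel. \<bar>h (y + t *\<^sub>R circ \<alpha> + s *\<^sub>R perp (circ \<alpha>))\<bar>) \<le> 4 * C * indicator {-2..2} t" for t \<alpha>
  proof -
    let ?H = "\<lambda>s. h (y + t *\<^sub>R circ \<alpha> + s *\<^sub>R perp (circ \<alpha>))"
    have c: "continuous_on UNIV ?H"
      by (intro continuous_on_compose2[OF h(1)] continuous_intros) auto
    have ca: "continuous_on UNIV (\<lambda>s. \<bar>?H s\<bar>)" by (intro continuous_intros c)
    have H0: "?H s = 0" if "2 \<le> \<bar>t\<bar> \<or> 2 \<le> \<bar>s\<bar>" for s
    proof -
      have "2 \<le> sqrt (t\<^sup>2 + s\<^sup>2)"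
        using that real_sqrt_sum_squares_ge1[of t s] real_sqrt_sum_squares_ge2[of s t]
          real_sqrt_ge_abs1[of t s] real_sqrt_ge_abs2[of s t] by linarith
      then show ?thesis using supp[of "t *\<^sub>R circ \<alpha> + s *\<^sub>R perp (circ \<alpha>)"]
        by (simp add: norm_circ_perp add.assoc)
    qed
    show "integrable lborel ?H"
      by (rule LBINT_eq_integral_of_support(1)[OF c, of "-2" 2]) (use H0 in auto)
    show "(LINT s|lborel. \<bar>?H s\<bar>) \<le> 4 * C * indicator {-2..2} t"
    proof (cases "\<bar>t\<bar> \<le> 2")
      case True
      have "(LINT s|lborel. \<bar>?H s\<bar>) = integral {-2..2} (\<lambda>s. \<bar>?H s\<bar>)"
        by (rule LBINT_eq_integral_of_support(2)[OF ca]) (use H0 in auto)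
      also have "\<dots> \<le> integral {-2..2::real} (\<lambda>s. C)"
        by (intro integral_le integrable_continuous_interval continuous_on_subset[OF ca] C continuous_intros) auto
      finally show ?thesis using True by (simp add: indicator_def abs_le_iff)
    next
      case False
      then have "?H s = 0" for s using H0 by simp
      then show ?thesis by (simp add: C0)
    qed
  qed
  have P_scale: "P (\<alpha>, t) u = y + t *\<^sub>R circ \<alpha> + (t * u) *\<^sub>R perp (circ \<alpha>)" for \<alpha> t u
    by (simp add: P_def algebra_simps)
  \<comment> \<open>For \<open>t = 0\<close> the argument of \<open>h\<close> does not depend on
    \<open>u\<close>, and integrability rests on \<open>ell 0 = 0\<close>.\<close>
  have iu: "integrable lborel (Z p)" for p
  proof (cases "snd p = 0")
    case True
    then show ?thesis by (simp add: Z_def[abs_def] ell0)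
  next
    case False
    obtain \<alpha> t where p: "p = (\<alpha>, t)" by (cases p)
    have "integrable lborel (\<lambda>u. h (P p u))"
      using lborel_integrable_real_affine[OF line(1)[of t \<alpha>], of t 0] False by (simp add: p P_scale)
    then show ?thesis unfolding Z_def by simp
  qed
  have ib: "integrable (lborel \<Otimes>\<^sub>M lborel) (\<lambda>p::real\<times>real. indicator {0..2*pi} (fst p) * (4 * C * (indicator {-2..2} (snd p) * \<bar>ln \<bar>snd p\<bar>\<bar>)))"
    (is "integrable _ ?b")
  proof (rule lborel_pair.Fubini_integrable)
    show "?b \<in> borel_measurable (lborel \<Otimes>\<^sub>M lborel)" by measurable
    show "integrable lborel (\<lambda>x. LINT y|lborel. norm (?b (x, y)))"
      by (simp add: abs_mult)
    show "AE x in lborel. integrable lborel (\<lambda>y. ?b (x, y))"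
      by (simp add: integrable_ln_abs)
  qed
  have iZ: "integrable (lborel \<Otimes>\<^sub>M lborel) (case_prod Z)"
  proof (rule lborel_pair.Fubini_integrable[OF mZ])
    show "AE x in lborel. integrable lborel (\<lambda>y. case (x, y) of (x, xa) \<Rightarrow> Z x xa)"
      using iu by simp
    have m: "(\<lambda>p. LINT u|lborel. \<bar>Z p u\<bar>) \<in> borel_measurable (lborel :: (real \<times> real) measure)"
      using mZ by (intro lborel.borel_measurable_lebesgue_integral) (auto simp: case_prod_unfold intro!: borel_measurable_abs)
    have "integrable (lborel :: (real \<times> real) measure) (\<lambda>p. LINT u|lborel. \<bar>Z p u\<bar>)"
    proof (rule Bochner_Integration.integrable_bound[OF ib[unfolded lborel_prod] m], intro AE_I2)
      fix p :: "real \<times> real"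
      obtain \<alpha> t where p: "p = (\<alpha>, t)" by (cases p)
      let ?H = "\<lambda>s. h (y + t *\<^sub>R circ \<alpha> + s *\<^sub>R perp (circ \<alpha>))"
      have "(LINT u|lborel. \<bar>Z p u\<bar>) \<le> ?b p"
      proof (cases "t = 0")
        case False
        have "(LINT u|lborel. \<bar>Z p u\<bar>) = indicator {0..2*pi} \<alpha> * (\<bar>ell t\<bar> * (LINT u|lborel. \<bar>?H (t * u)\<bar>))"
          by (simp add: Z_def p P_scale abs_mult)
        \<comment> \<open>Undoing \<open>s = t * u\<close> uses up the factor
          \<open>\<bar>t\<bar>\<close> of \<open>ell\<close>, leaving the locally integrable
          \<open>\<bar>ln \<bar>t\<bar>\<bar>\<close> of the majorant.\<close>
        also have "\<bar>ell t\<bar> * (LINT u|lborel. \<bar>?H (t * u)\<bar>) = \<bar>ln \<bar>t\<bar>\<bar> * (LINT s|lborel. \<bar>?H s\<bar>)"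
          using False lborel_integral_real_affine[of t "\<lambda>s. \<bar>?H s\<bar>" 0] by (simp add: ell_def abs_mult)
        also have "indicator {0..2*pi} \<alpha> * (\<bar>ln \<bar>t\<bar>\<bar> * (LINT s|lborel. \<bar>?H s\<bar>)) \<le>
            indicator {0..2*pi} \<alpha> * (\<bar>ln \<bar>t\<bar>\<bar> * (4 * C * indicator {-2..2} t))"
          by (intro mult_left_mono line(2)) auto
        also have "\<dots> = ?b p" by (simp add: p mult_ac)
        finally show ?thesis .
      qed (use C0 in \<open>simp add: Z_def p ell0\<close>)
      moreover have "0 \<le> (LINT u|lborel. \<bar>Z p u\<bar>)" by (rule Bochner_Integration.integral_nonneg) auto
      ultimately show "norm (LINT u|lborel. \<bar>Z p u\<bar>) \<le> norm (?b p)" by simp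
    qed
    then show "integrable lborel (\<lambda>x. LINT y|lborel. norm (case (x, y) of (x, xa) \<Rightarrow> Z x xa))" by simp
  qed
  \<comment> \<open>For fixed \<open>u\<close> the integrand is continuous on a rectangle and zero
    outside it, since the distance of \<open>P (\<alpha>, t) u\<close> from \<open>y\<close> is at
    least \<open>\<bar>t\<bar>\<close>.\<close>
  have slice: "integrable (lborel \<Otimes>\<^sub>M lborel) (\<lambda>(\<alpha>, t). Z (\<alpha>, t) u)" for u
  proof -
    have "integrable lborel (\<lambda>p. indicator ({0..2*pi} \<times> {-2..2}) p *\<^sub>R (ell (snd p) * h (P p u)))"
      by (intro borel_integrable_compact compact_Times continuous_intros continuous_on_compose2[OF cell] continuous_on_compose2[OF cP, of _ "\<lambda>p. (p, u)", simplified]) auto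
    moreover have "indicator ({0..2*pi} \<times> {-2..2}) p *\<^sub>R (ell (snd p) * h (P p u)) = Z p u" for p
    proof -
      obtain \<alpha> t where p: "p = (\<alpha>, t)" by (cases p)
      show ?thesis
      proof (cases "\<bar>t\<bar> \<le> 2")
        case True
        then show ?thesis by (auto simp: p Z_def indicator_def)
      next
        case False
        have "\<bar>t\<bar> \<le> norm (P (\<alpha>, t) u - y)" unfolding normP by (rule real_sqrt_ge_abs1)
        then have "h (P (\<alpha>, t) u) = 0" using supp[of "P (\<alpha>, t) u - y"] False by simp
        then show ?thesis by (simp add: p Z_def)
      qed
    qed
    ultimately show ?thesis by (simp add: lborel_prod case_prod_unfold)
  qed
  define M where "M = circ_mean h y"
  have cM: "continuous_on UNIV M" unfolding M_def by (rule continuous_on_circ_mean[OF h(1)])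
  have M0: "M w = 0" if "2 \<le> \<bar>w\<bar>" for w unfolding M_def using circ_mean_eq_0[of h y w] h(2) y that by simp
  define A B where "A = (LINT w|lborel. ell w * M w)" and "B = (LINT w|lborel. \<bar>w\<bar> * M w)"
  have iAB: "integrable lborel (\<lambda>w. ell w * M w)" "integrable lborel (\<lambda>w. \<bar>w\<bar> * M w)"
    by (rule LBINT_eq_integral_of_support(1)[where a="-2" and b=2], auto intro!: continuous_intros cell cM M0)+
  have inner: "(LINT p|lborel. Z p u) = inverse (1 + u\<^sup>2) * (A - ln (sqrt (1 + u\<^sup>2)) * B)" for u
  proof -
    define k where "k = sqrt (1 + u\<^sup>2)"
    have k: "k > 0" "k\<^sup>2 = 1 + u\<^sup>2" by (simp_all add: k_def add_pos_nonneg)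
    have av: "(LINT \<alpha>|lborel. Z (\<alpha>, t) u) = ell t * M (k * t)" for t
    proof -
      have c: "continuous_on A' (\<lambda>\<alpha>. h (y + (k * t) *\<^sub>R circ (\<alpha> + arctan u)))" for A'
        by (intro continuous_on_compose2[OF h(1)] continuous_intros) auto
      have "P (\<alpha>, t) u = y + (k * t) *\<^sub>R circ (\<alpha> + arctan u)" for \<alpha>
        by (simp add: P_def circ_rotate_arctan k_def mult.commute)
      then have "(LINT \<alpha>|lborel. Z (\<alpha>, t) u) =
          ell t * (LINT \<alpha>:{0..2*pi}|lborel. h (y + (k * t) *\<^sub>R circ (\<alpha> + arctan u)))"
        by (simp add: Z_def set_lebesgue_integral_def mult.left_commute)
      also have "(LINT \<alpha>:{0..2*pi}|lborel. h (y + (k * t) *\<^sub>R circ (\<alpha> + arctan u))) =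
          integral {0..2*pi} (\<lambda>\<alpha>. h (y + (k * t) *\<^sub>R circ (\<alpha> + arctan u)))"
        by (intro set_borel_integral_eq_integral borel_integrable_atLeastAtMost' c)
      also have "\<dots> = M (k * t)" unfolding M_def
        by (rule circ_mean_shift[OF h(1)]) (use arctan_bounded[of u] pi_gt_zero in \<open>auto simp: abs_le_iff\<close>)
      finally show ?thesis .
    qed
    have "(LINT p|lborel. Z p u) = (LINT t|lborel. LINT \<alpha>|lborel. Z (\<alpha>, t) u)"
      using lborel_pair.integral_snd[OF slice] by (simp add: lborel_prod case_prod_unfold)
    also have "\<dots> = (LINT t|lborel. ell t * M (k * t))" unfolding av ..
    \<comment> \<open>Here \<open>w = k * t\<close>. One factor \<open>1 / k\<close> comes from the
      substitution and one from \<open>ell (w / k)\<close>; together they form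
      \<open>inverse (1 + u\<^sup>2)\<close>.\<close>
    also have "\<dots> = (LINT w|lborel. ell (w / k) * M w) / k"
      using k lborel_integral_real_affine[of "1 / k" "\<lambda>t. ell t * M (k * t)" 0] by simp
    also have "(LINT w|lborel. ell (w / k) * M w) = (LINT w|lborel. (ell w * M w - ln k * (\<bar>w\<bar> * M w)) / k)"
      unfolding ell_def abs_ln_abs_divide[OF k(1)]
      by (intro Bochner_Integration.integral_cong) (auto simp: algebra_simps diff_divide_distrib)
    also have "\<dots> = (A - ln k * B) / k"
      unfolding A_def B_def using iAB by simp
    also have "(A - ln k * B) / k / k = inverse (1 + u\<^sup>2) * (A - ln k * B)"
      using k(1) unfolding k(2)[symmetric] by (simp add: field_simps power2_eq_square)
    finally show ?thesis by (simp add: k_def)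
  qed
  have iu: "integrable lborel (\<lambda>u. inverse (1 + u\<^sup>2) * (A - ln (sqrt (1 + u\<^sup>2)) * B))"
    using lborel_pair.integrable_snd[OF iZ] unfolding inner .
  txt \<open>If \<^term>\<open>B \<noteq> 0\<close>, the integrability of the logarithmic term follows from Fubini
    and need not be checked directly.\<close>
  have outer: "(LINT u|lborel. inverse (1 + u\<^sup>2) * (A - ln (sqrt (1 + u\<^sup>2)) * B)) = pi * A - log_const * B"
  proof (cases "B = 0")
    case True
    then show ?thesis using LBINT_inverse_1_plus_square_lborel by simp
  next
    case False
    have "integrable lborel (\<lambda>u. (inverse (1 + u\<^sup>2) * A - inverse (1 + u\<^sup>2) * (A - ln (sqrt (1 + u\<^sup>2)) * B)) / B)"
      by (intro integrable_divide Bochner_Integration.integrable_diff iu integrable_mult_left LBINT_inverse_1_plus_square_lborel)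
    then have i: "integrable lborel (\<lambda>u::real. inverse (1 + u\<^sup>2) * ln (sqrt (1 + u\<^sup>2)))"
      using False by (simp add: algebra_simps)
    have "(LINT u|lborel. inverse (1 + u\<^sup>2) * (A - ln (sqrt (1 + u\<^sup>2)) * B)) =
       (LINT u|lborel. inverse (1 + u\<^sup>2) * A - inverse (1 + u\<^sup>2) * ln (sqrt (1 + u\<^sup>2)) * B)"
      by (intro Bochner_Integration.integral_cong) (auto simp: algebra_simps)
    also have "\<dots> = pi * A - log_const * B"
      using i LBINT_inverse_1_plus_square_lborel by (simp add: log_const_def)
    finally show ?thesis .
  qed
  define Q where "Q = (\<lambda>\<alpha>. LINT t|lborel. LINT u|lborel.
        \<bar>t\<bar> * ln \<bar>t\<bar> * h (y + t *\<^sub>R (circ \<alpha> + u *\<^sub>R perp (circ \<alpha>))))"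
  have QZ: "indicator {0..2 * pi} \<alpha> *\<^sub>R (2 * Q \<alpha>) = 2 * (LINT t|lborel. LINT u|lborel. Z (\<alpha>, t) u)" for \<alpha>
    by (cases "\<alpha> \<in> {0..2 * pi}") (simp_all add: Z_def P_def ell_def Q_def)
  have "(LBINT t=-1..1. V f (circ \<alpha>) t * ln \<bar>t - circ \<alpha> \<bullet> y\<bar> / sqrt (1 - t\<^sup>2)) = 2 * Q \<alpha>" for \<alpha>
    unfolding Q_def by (rule slice_log_integral[OF h f])
  then have "arc_integral circ 0 (2 * pi) (\<lambda>\<theta>. LBINT t=-1..1. V f \<theta> t * ln \<bar>t - \<theta> \<bullet> y\<bar> / sqrt (1 - t\<^sup>2))
    = (LBINT \<alpha>=0..2*pi. 2 * Q \<alpha>)"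
    unfolding arc_integral_circ by simp
  also have "\<dots> = 2 * (LINT \<alpha>|lborel. LINT t|lborel. LINT u|lborel. Z (\<alpha>, t) u)"
    using interval_integral_Icc[of 0 "2*pi" "\<lambda>\<alpha>. 2 * Q \<alpha>"]
    unfolding set_lebesgue_integral_def QZ by (simp add: zero_ereal_def)
  also have "(LINT \<alpha>|lborel. LINT t|lborel. LINT u|lborel. Z (\<alpha>, t) u) = (LINT p|lborel. LINT u|lborel. Z p u)"
    using lborel_pair.integral_fst'[of "\<lambda>p. LINT u|lborel. Z p u"] lborel_pair.integrable_fst[OF iZ]
    by (simp add: lborel_prod)
  also have "\<dots> = (LINT u|lborel. LINT p|lborel. Z p u)"
    by (rule lborel_pair.Fubini_integral[OF iZ, symmetric])
  also have "\<dots> = pi * A - log_const * B"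
    unfolding inner outer ..
  also have "2 * (pi * A - log_const * B) = (LINT w|lborel. polar_kernel w * M w)"
  proof -
    have "(LINT w|lborel. polar_kernel w * M w) = (LINT w|lborel. 2 * (pi * (ell w * M w) - log_const * (\<bar>w\<bar> * M w)))"
      by (intro Bochner_Integration.integral_cong) (auto simp: polar_kernel_def ell_def algebra_simps)
    then show ?thesis unfolding A_def B_def using iAB by simp
  qed
  also have "\<dots> = integral {-2..2} (\<lambda>w. polar_kernel w * M w)"
    by (rule LBINT_eq_integral_of_support(2)) (auto intro!: continuous_intros continuous_on_polar_kernel cM M0)
  finally show ?thesis by (simp add: M_def)
qed

section \<open>The Laplacian in polar form\<close>

text \<open>A single integral over a box with continuous integrand, so that one application of the
  Leibniz rule differentiates it in \<open>y\<close>. It makes sense for every \<open>y\<close> and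
  agrees with the logarithmic integral inside the disc.\<close>

definition polar_integral :: "(real \<times> real \<Rightarrow> real) \<Rightarrow> real \<times> real \<Rightarrow> real" where
  "polar_integral u y = integral (cbox (-2, 0) (2, 2 * pi))
     (\<lambda>q. polar_kernel (fst q) * u (y + fst q *\<^sub>R circ (snd q)))"

lemma continuous_on_polar_integrand:
  assumes "continuous_on UNIV u"
  shows "continuous_on A (\<lambda>q. polar_kernel (fst q) * u (y + fst q *\<^sub>R circ (snd q)))"
  by (intro continuous_intros continuous_on_compose2[OF continuous_on_polar_kernel] continuous_on_compose2[OF assms]) auto

lemma polar_integral_eq_circ_mean:
  assumes "continuous_on UNIV u"
  shows "polar_integral u y = integral {-2..2} (\<lambda>w. polar_kernel w * circ_mean u y w)"
  unfolding polar_integral_def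
  by (subst integral_prod_continuous[OF continuous_on_polar_integrand[OF assms]])
    (simp add: circ_mean_def)

lemma polar_integral_add:
  assumes "continuous_on UNIV u" "continuous_on UNIV w"
  shows "polar_integral (\<lambda>x. u x + w x) y = polar_integral u y + polar_integral w y"
  unfolding polar_integral_def distrib_left
  by (intro integral_add integrable_continuous continuous_on_polar_integrand assms)

lemma has_real_derivative_along_curve:
  fixes \<gamma> :: "real \<Rightarrow> real \<times> real"
  assumes u: "(u has_derivative (\<lambda>v. fst v * u1 + snd v * u2)) (at (\<gamma> s))"
    and \<gamma>: "(\<gamma> has_vector_derivative v) (at s within S)"
  shows "((\<lambda>s. u (\<gamma> s)) has_real_derivative fst v * u1 + snd v * u2) (at s within S)"
proof -
  have "((\<lambda>s. u (\<gamma> s)) has_derivative (\<lambda>x. fst (x *\<^sub>R v) * u1 + snd (x *\<^sub>R v) * u2)) (at s within S)"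
    using has_derivative_compose[OF \<gamma>[unfolded has_vector_derivative_def] u] .
  then show ?thesis unfolding has_field_derivative_def
    by (rule has_derivative_eq_rhs) (auto simp: algebra_simps fun_eq_iff)
qed

text \<open>The kernel does not involve the base point, so every derivative falls on
  \<open>u\<close>.\<close>

lemma has_real_derivative_polar_integral:
  assumes u: "\<And>x. (u has_derivative (\<lambda>v. fst v * u1 x + snd v * u2 x)) (at x)"
    and c: "continuous_on UNIV u1" "continuous_on UNIV u2"
  shows "((\<lambda>s. polar_integral u (p + s *\<^sub>R v)) has_real_derivative
    polar_integral (\<lambda>x. fst v * u1 x + snd v * u2 x) (p + s *\<^sub>R v)) (at s)"
  unfolding polar_integral_def
proof (rule leibniz_rule_field_derivative)
  have cu: "continuous_on UNIV u"
    by (intro continuous_at_imp_continuous_on ballI has_derivative_continuous[OF u])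
  show "(\<lambda>q. polar_kernel (fst q) * u (p + s *\<^sub>R v + fst q *\<^sub>R circ (snd q))) integrable_on cbox (-2, 0) (2, 2 * pi)" for s
    by (intro integrable_continuous continuous_on_polar_integrand cu)
  show "continuous_on (UNIV \<times> cbox (-2, 0) (2, 2 * pi))
    (\<lambda>(s, q). polar_kernel (fst q) * (fst v * u1 (p + s *\<^sub>R v + fst q *\<^sub>R circ (snd q))
      + snd v * u2 (p + s *\<^sub>R v + fst q *\<^sub>R circ (snd q))))"
    unfolding case_prod_unfold
    by (intro continuous_intros continuous_on_compose2[OF continuous_on_polar_kernel]
        continuous_on_compose2[OF c(1)] continuous_on_compose2[OF c(2)]) auto
  fix s :: real and q :: "real \<times> real"
  have "((\<lambda>s. p + s *\<^sub>R v + fst q *\<^sub>R circ (snd q)) has_vector_derivative v) (at s)"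
    by (auto intro!: derivative_eq_intros)
  from has_real_derivative_along_curve[OF u this]
  show "((\<lambda>s. polar_kernel (fst q) * u (p + s *\<^sub>R v + fst q *\<^sub>R circ (snd q))) has_real_derivative
     polar_kernel (fst q) * (fst v * u1 (p + s *\<^sub>R v + fst q *\<^sub>R circ (snd q))
      + snd v * u2 (p + s *\<^sub>R v + fst q *\<^sub>R circ (snd q)))) (at s)"
    by (rule DERIV_cmult)
qed auto

section \<open>Radial derivatives of circular means\<close>

lemma has_real_derivative_integral_circle:
  fixes F :: "real \<Rightarrow> real \<Rightarrow> real"
  assumes "\<And>w \<alpha>. ((\<lambda>w. F w \<alpha>) has_real_derivative F' w \<alpha>) (at w)"
    and "\<And>w. continuous_on UNIV (F w)" and "continuous_on UNIV (\<lambda>q. F' (fst q) (snd q))"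
  shows "((\<lambda>w. integral {0..2 * pi} (F w)) has_real_derivative integral {0..2 * pi} (F' w)) (at w)"
proof -
  have "((\<lambda>w. integral (cbox 0 (2 * pi)) (F w)) has_real_derivative integral (cbox 0 (2 * pi)) (F' w)) (at w)"
  proof (rule leibniz_rule_field_derivative)
    show "F w integrable_on cbox 0 (2*pi)" for w
      by (intro integrable_continuous continuous_on_subset[OF assms(2)]) auto
    show "continuous_on (UNIV \<times> cbox 0 (2 * pi)) (\<lambda>(w, \<alpha>). F' w \<alpha>)"
      using continuous_on_subset[OF assms(3)] by (auto simp: case_prod_unfold)
  qed (use assms(1) in auto)
  then show ?thesis by simp
qed

text \<open>For \<open>w > 0\<close> the integrand is \<open>2 * (pi * ln w - log_const)\<close>
  times the derivative of \<open>w * M1 w\<close>, which has the explicit antiderivative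
  \<open>E\<close>. Only the end point 0 contributes, giving \<open>4 * pi\<^sup>2 * h y\<close>;
  evenness in \<open>w\<close> doubles this.\<close>

lemma polar_integral_laplacian:
  assumes h: "\<And>x. (h has_derivative (\<lambda>v. fst v * h1 x + snd v * h2 x)) (at x)"
    and h1: "\<And>x. (h1 has_derivative (\<lambda>v. fst v * h11 x + snd v * h12 x)) (at x)"
    and h2: "\<And>x. (h2 has_derivative (\<lambda>v. fst v * h21 x + snd v * h22 x)) (at x)"
    and c: "continuous_on UNIV h11" "continuous_on UNIV h12" "continuous_on UNIV h21" "continuous_on UNIV h22"
    and h0: "\<And>x. norm x \<ge> 1 \<Longrightarrow> h x = 0"
    and y: "norm y < 1"
  shows "polar_integral (\<lambda>x. h11 x + h22 x) y = 8 * pi\<^sup>2 * h y"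
proof -
  have ch: "continuous_on UNIV h" "continuous_on UNIV h1" "continuous_on UNIV h2"
    by (intro continuous_at_imp_continuous_on ballI has_derivative_continuous[OF h]
        has_derivative_continuous[OF h1] has_derivative_continuous[OF h2])+
  have cc: "continuous_on A (\<lambda>x. u (y + g x *\<^sub>R circ (k x)))"
    if "continuous_on UNIV u" "continuous_on A g" "continuous_on A k"
    for u :: "real \<times> real \<Rightarrow> real" and A :: "'b::t2_space set" and g k
    by (intro continuous_intros continuous_on_compose2[OF that(1)] that) auto
  note [continuous_intros] = cc[OF ch(1)] cc[OF ch(2)] cc[OF ch(3)]
    cc[OF c(1)] cc[OF c(2)] cc[OF c(3)] cc[OF c(4)]
  define L where "L = (\<lambda>x. h11 x + h22 x)"
  have cL: "continuous_on UNIV L" unfolding L_def by (intro continuous_intros c)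
  let ?z = "\<lambda>w \<alpha>. y + w *\<^sub>R circ \<alpha>"
  \<comment> \<open>\<open>k1\<close> and \<open>k2\<close> are the first and second derivatives of
    \<open>h\<close> along the ray of angle \<open>\<alpha>\<close> from \<open>y\<close>;
    \<open>M1\<close> and \<open>M2\<close> are those of \<open>M\<close>.\<close>
  define k1 where "k1 = (\<lambda>w \<alpha>. cos \<alpha> * h1 (?z w \<alpha>) + sin \<alpha> * h2 (?z w \<alpha>))"
  define k2 where "k2 = (\<lambda>w \<alpha>. cos \<alpha> * (cos \<alpha> * h11 (?z w \<alpha>) + sin \<alpha> * h12 (?z w \<alpha>))
    + sin \<alpha> * (cos \<alpha> * h21 (?z w \<alpha>) + sin \<alpha> * h22 (?z w \<alpha>)))"
  define M where "M = circ_mean h y"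
  define M1 where "M1 = (\<lambda>w. integral {0..2 * pi} (k1 w))"
  define M2 where "M2 = (\<lambda>w. integral {0..2 * pi} (k2 w))"
  have dw: "((\<lambda>w. u (?z w \<alpha>)) has_real_derivative cos \<alpha> * a + sin \<alpha> * b) (at w)"
    if "(u has_derivative (\<lambda>v. fst v * a + snd v * b)) (at (?z w \<alpha>))" for u a b w \<alpha>
  proof -
    have "((\<lambda>w. ?z w \<alpha>) has_vector_derivative circ \<alpha>) (at w)"
      by (auto intro!: derivative_eq_intros)
    from has_real_derivative_along_curve[OF that this] show ?thesis by (simp add: circ_def)
  qed
  have da: "((\<lambda>\<alpha>. u (?z w \<alpha>)) has_real_derivative w * (cos \<alpha> * b - sin \<alpha> * a)) (at \<alpha>)"
    if "(u has_derivative (\<lambda>v. fst v * a + snd v * b)) (at (?z w \<alpha>))" for u a b w \<alpha>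
  proof -
    have "(circ has_vector_derivative (- sin \<alpha>, cos \<alpha>)) (at \<alpha>)" unfolding circ_def
      by (auto intro!: derivative_eq_intros has_vector_derivative_Pair
        simp flip: has_real_derivative_iff_has_vector_derivative)
    then have "((\<lambda>\<alpha>. ?z w \<alpha>) has_vector_derivative w *\<^sub>R (- sin \<alpha>, cos \<alpha>)) (at \<alpha>)"
      by (auto intro!: derivative_eq_intros)
    from has_real_derivative_along_curve[OF that this] show ?thesis
      by (simp add: algebra_simps)
  qed
  have dM: "(M has_real_derivative M1 w) (at w)" for w
    unfolding M_def M1_def circ_mean_def[abs_def] k1_def
    by (rule has_real_derivative_integral_circle) (auto intro!: dw h continuous_intros)
  have "((\<lambda>w. k1 w \<alpha>) has_real_derivative k2 w \<alpha>) (at w)" for w \<alpha>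
    unfolding k1_def k2_def by (intro DERIV_add DERIV_cmult dw h1 h2)
  then have dM1: "(M1 has_real_derivative M2 w) (at w)" for w
    unfolding M1_def M2_def
    by (rule has_real_derivative_integral_circle)
      (auto simp: k1_def[abs_def] k2_def intro!: continuous_intros)
  have cM: "continuous_on A M" "continuous_on A M1" for A
    using DERIV_isCont[OF dM] DERIV_isCont[OF dM1] by (auto intro!: continuous_at_imp_continuous_on)
  txt \<open>This is the Laplacian in polar coordinates; the second angular derivative
    integrates to zero over the circle.\<close>
  have polar: "w\<^sup>2 * circ_mean L y w = w\<^sup>2 * M2 w + w * M1 w" for w
  proof -
    \<comment> \<open>\<open>ka\<close> is the first angular derivative. Its derivative is rewritten
      as \<open>kaa\<close> using only
      \<open>(cos \<alpha>)\<^sup>2 + (sin \<alpha>)\<^sup>2 = 1\<close>; the terms in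
      \<open>h12\<close> and in \<open>h21\<close> cancel separately.\<close>
    define ka where "ka = (\<lambda>\<alpha>. w * (cos \<alpha> * h2 (?z w \<alpha>) - sin \<alpha> * h1 (?z w \<alpha>)))"
    define kaa where "kaa = (\<lambda>\<alpha>. w\<^sup>2 * L (?z w \<alpha>) - w\<^sup>2 * k2 w \<alpha> - w * k1 w \<alpha>)"
    have "(ka has_real_derivative kaa \<alpha>) (at \<alpha>)" for \<alpha>
    proof -
      have "(ka has_real_derivative w * ((- sin \<alpha> * h2 (?z w \<alpha>) + w * (cos \<alpha> * h22 (?z w \<alpha>) - sin \<alpha> * h21 (?z w \<alpha>)) * cos \<alpha>)
         - (cos \<alpha> * h1 (?z w \<alpha>) + w * (cos \<alpha> * h12 (?z w \<alpha>) - sin \<alpha> * h11 (?z w \<alpha>)) * sin \<alpha>))) (at \<alpha>)"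
        unfolding ka_def
        by (intro DERIV_cmult DERIV_diff DERIV_mult DERIV_cos DERIV_sin da h1 h2)
      moreover have "w * ((- sin \<alpha> * h2 (?z w \<alpha>) + w * (cos \<alpha> * h22 (?z w \<alpha>) - sin \<alpha> * h21 (?z w \<alpha>)) * cos \<alpha>)
         - (cos \<alpha> * h1 (?z w \<alpha>) + w * (cos \<alpha> * h12 (?z w \<alpha>) - sin \<alpha> * h11 (?z w \<alpha>)) * sin \<alpha>)) = kaa \<alpha>"
      proof -
        have "(cos \<alpha>)\<^sup>2 + (sin \<alpha>)\<^sup>2 = 1" by simp
        then show ?thesis unfolding kaa_def k1_def k2_def L_def by algebra
      qed
      ultimately show ?thesis by simp
    qed
    then have "(kaa has_integral (ka (2 * pi) - ka 0)) {0..2 * pi}"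
      by (intro fundamental_theorem_of_calculus)
        (auto simp flip: has_real_derivative_iff_has_vector_derivative intro: has_field_derivative_at_within)
    moreover have "ka (2 * pi) = ka 0" using circ_add_2pi[of 0] by (simp add: ka_def)
    ultimately have "integral {0..2 * pi} kaa = 0" by (simp add: integral_unique)
    moreover have "integral {0..2 * pi} kaa = w\<^sup>2 * circ_mean L y w - w\<^sup>2 * M2 w - w * M1 w"
    proof -
      have i: "(\<lambda>\<alpha>. L (?z w \<alpha>)) integrable_on {0..2 * pi}" "k1 w integrable_on {0..2 * pi}" "k2 w integrable_on {0..2 * pi}"
        unfolding k1_def k2_def L_def by (intro integrable_continuous_interval continuous_intros)+
      show ?thesis
        unfolding kaa_def circ_mean_def M1_def M2_def
        by (intro integral_unique has_integral_diff has_integral_mult_right integrable_integral i)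
    qed
    ultimately show ?thesis by simp
  qed
  have M0: "M w = 0" if "1 + norm y \<le> \<bar>w\<bar>" for w
    unfolding M_def using circ_mean_eq_0[of h y w] h0 that by simp
  \<comment> \<open>As \<open>1 + norm y < 2\<close>, the mean \<open>M\<close> vanishes on a whole
    neighbourhood of 2.\<close>
  have M1_2: "M1 2 = 0"
  proof -
    have "(M has_real_derivative 0) (at 2)"
      by (rule has_field_derivative_transform_within_open[OF DERIV_const[of 0] open_greaterThan[of "1 + norm y"]])
        (use y M0 in auto)
    then show ?thesis using DERIV_unique[OF dM] by simp
  qed
  \<comment> \<open>The term \<open>pi * M w\<close> cancels the extra \<open>pi * M1 w\<close> that
    arises from differentiating the logarithm. Writing
    \<open>\<bar>w\<bar> * ln \<bar>w\<bar>\<close> keeps \<open>E\<close> visibly continuous at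
    0.\<close>
  define E where "E = (\<lambda>w. 2 * ((pi * (\<bar>w\<bar> * ln \<bar>w\<bar>) - log_const * w) * M1 w - pi * M w))"
  have half: "((\<lambda>w. polar_kernel w * circ_mean L y w) has_integral (E 2 - E 0)) {0..2}"
  proof (rule fundamental_theorem_of_calculus_interior)
    show "continuous_on {0..2} E" unfolding E_def
      by (intro continuous_intros continuous_on_subset[OF continuous_on_abs_ln_abs] cM) auto
    fix w :: real assume w: "w \<in> {0<..<2}"
    then have "w * (w * circ_mean L y w) = w * (w * M2 w + M1 w)"
      using polar[of w] by (simp add: power2_eq_square algebra_simps)
    then have p: "w * circ_mean L y w = w * M2 w + M1 w" using w by simp
    have dln: "(ln has_real_derivative inverse w) (at w)" using w by (intro DERIV_ln) simp
    have "((\<lambda>w. 2 * ((pi * (w * ln w) - log_const * w) * M1 w - pi * M w)) has_real_derivative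
        2 * (pi * ln w - log_const) * (w * M2 w + M1 w)) (at w)"
      by (rule DERIV_cong, (rule DERIV_cmult DERIV_diff DERIV_mult DERIV_ident dln dM dM1)+)
        (use w in \<open>simp_all add: field_simps\<close>)
    then have "(E has_real_derivative 2 * (pi * ln w - log_const) * (w * M2 w + M1 w)) (at w)"
      by (rule has_field_derivative_transform_within_open[OF _ open_greaterThan[of 0]]) (use w in \<open>auto simp: E_def\<close>)
    moreover have "2 * (pi * ln w - log_const) * (w * M2 w + M1 w) = polar_kernel w * circ_mean L y w"
      unfolding p[symmetric] using w by (simp add: polar_kernel_def algebra_simps)
    ultimately show "(E has_vector_derivative polar_kernel w * circ_mean L y w) (at w)"
      by (simp add: has_real_derivative_iff_has_vector_derivative)
  qed simp
  have "E 2 = 0" using M0[of 2] y M1_2 by (simp add: E_def)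
  moreover have "E 0 = - (4 * pi\<^sup>2 * h y)"
    by (simp add: E_def M_def circ_mean_def power2_eq_square)
  ultimately have half': "integral {0..2} (\<lambda>w. polar_kernel w * circ_mean L y w) = 4 * pi\<^sup>2 * h y"
    using half by (simp add: integral_unique)
  have i: "(\<lambda>w. polar_kernel w * circ_mean L y w) integrable_on {-2..2}"
    by (intro integrable_continuous_interval continuous_intros
        continuous_on_subset[OF continuous_on_polar_kernel]
        continuous_on_subset[OF continuous_on_circ_mean[OF cL]]) auto
  have "integral {-2..0} (\<lambda>w. polar_kernel w * circ_mean L y w) = integral {-2..-0} (\<lambda>w. polar_kernel (- w) * circ_mean L y (- w))"
    by (simp add: polar_kernel_def circ_mean_minus[OF cL])
  also have "\<dots> = 4 * pi\<^sup>2 * h y"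
    using Henstock_Kurzweil_Integration.integral_reflect_real[of 2 0 "\<lambda>w. polar_kernel w * circ_mean L y w"] half' by simp
  finally have "integral {-2..2} (\<lambda>w. polar_kernel w * circ_mean L y w) = 8 * pi\<^sup>2 * h y"
    using half' Henstock_Kurzweil_Integration.integral_combine[OF _ _ i, of 0]
    by (simp add: mult_ac)
  then show ?thesis using polar_integral_eq_circ_mean[OF cL, of y] by (simp add: L_def)
qed

section \<open>Second derivatives of the logarithmic integral along the coordinate axes\<close>

theorem theorem3p2:
  fixes f :: "(real \<times> real) \<times> real \<Rightarrow> real"
    and x' :: "real \<times> real" and x3 :: real
  assumes "f \<in> Ctilde_e"
    and "(x', x3) \<in> sphere 0 1"
    and "norm x' < 1"
  defines "G \<equiv> (\<lambda>y'. arc_integral circ 0 (2 * pi)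
             (\<lambda>\<theta>. LBINT t=-1..1. V f \<theta> t * ln \<bar>t - \<theta> \<bullet> y'\<bar> / sqrt (1 - t\<^sup>2)))"
  shows "has_second_partials G x'
    \<and> f (x', x3) = \<bar>x3\<bar> / (8 * pi\<^sup>2) * laplacian G x'"
proof -
  obtain h where h: "Ck (Suc (Suc 0)) UNIV h" "\<And>x. norm x \<ge> 1 \<Longrightarrow> h x = 0"
    "\<And>x' x3. (x', x3) \<in> sphere 0 1 \<Longrightarrow> f (x', x3) = \<bar>x3\<bar> * h x'"
    by (rule Ctilde_e_planar_density[OF assms(1)]) (rule that)
  from h(1) obtain h1 h2 where dh: "\<And>x. x \<in> UNIV \<Longrightarrow> (h has_derivative (\<lambda>v. fst v * h1 x + snd v * h2 x)) (at x)"
    and C1: "Ck (Suc 0) UNIV h1" "Ck (Suc 0) UNIV h2"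
    by (rule Ck_SucE) (rule that)
  from C1(1) obtain h11 h12 where dh1: "\<And>x. x \<in> UNIV \<Longrightarrow> (h1 has_derivative (\<lambda>v. fst v * h11 x + snd v * h12 x)) (at x)"
    and C11: "Ck 0 UNIV h11" "Ck 0 UNIV h12"
    by (rule Ck_SucE) (rule that)
  from C1(2) obtain h21 h22 where dh2: "\<And>x. x \<in> UNIV \<Longrightarrow> (h2 has_derivative (\<lambda>v. fst v * h21 x + snd v * h22 x)) (at x)"
    and C22: "Ck 0 UNIV h21" "Ck 0 UNIV h22"
    by (rule Ck_SucE) (rule that)
  note D = dh[OF UNIV_I] dh1[OF UNIV_I] dh2[OF UNIV_I]
  note c = C11[simplified] C22[simplified]
  note c1 = C1[THEN Ck_continuous_on]
  have G: "G y = polar_integral h y" if "norm y < 1" for y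
    unfolding G_def polar_integral_eq_circ_mean[OF Ck_continuous_on[OF h(1)]]
    by (rule log_integral_eq_polar[OF Ck_continuous_on[OF h(1)] h(2,3) that])
  \<comment> \<open>\<open>G\<close> is identified with \<open>polar_integral h\<close> only inside
    the unit disc. Derivatives along a line through \<open>x'\<close> are therefore transferred on
    the open set \<open>N\<close> of parameters that stay in the disc; the second one requires the
    first on all of \<open>N\<close>.\<close>
  have line: "(\<forall>\<^sub>F s in nhds 0. (\<lambda>s. G (x' + s *\<^sub>R v)) differentiable (at s))
      \<and> (deriv (\<lambda>s. G (x' + s *\<^sub>R v)) has_real_derivative polar_integral u11 x') (at 0)"
    if d: "\<And>s. ((\<lambda>s. polar_integral h (x' + s *\<^sub>R v)) has_real_derivative polar_integral u1 (x' + s *\<^sub>R v)) (at s)"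
      and dd: "\<And>s. ((\<lambda>s. polar_integral u1 (x' + s *\<^sub>R v)) has_real_derivative polar_integral u11 (x' + s *\<^sub>R v)) (at s)"
    for v u1 u11
  proof -
    define N where "N = {s::real. norm (x' + s *\<^sub>R v) < 1}"
    have N: "open N" "0 \<in> N" unfolding N_def
      using assms(3) by (auto intro!: open_Collect_less continuous_intros)
    have dG: "((\<lambda>s. G (x' + s *\<^sub>R v)) has_real_derivative polar_integral u1 (x' + s *\<^sub>R v)) (at s)" if "s \<in> N" for s
      by (rule has_field_derivative_transform_within_open[OF d N(1) that]) (simp add: G N_def)
    have "\<forall>\<^sub>F s in nhds 0. (\<lambda>s. G (x' + s *\<^sub>R v)) differentiable (at s)"
      using eventually_nhds_in_open[OF N] by eventually_elim (use dG real_differentiable_def in blast)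
    moreover have "(deriv (\<lambda>s. G (x' + s *\<^sub>R v)) has_real_derivative polar_integral u11 (x' + 0 *\<^sub>R v)) (at 0)"
      by (rule has_field_derivative_transform_within_open[OF dd N]) (simp add: DERIV_imp_deriv[OF dG])
    ultimately show ?thesis by simp
  qed
  have l1: "(\<forall>\<^sub>F s in nhds 0. (\<lambda>s. G (x' + s *\<^sub>R (1,0))) differentiable (at s))
      \<and> (deriv (\<lambda>s. G (x' + s *\<^sub>R (1,0))) has_real_derivative polar_integral h11 x') (at 0)"
    using has_real_derivative_polar_integral[OF D(1) c1, where v="(1,0)"]
      has_real_derivative_polar_integral[OF D(2) c(1,2), where v="(1,0)"]
    by (intro line) simp_all
  have l2: "(\<forall>\<^sub>F s in nhds 0. (\<lambda>s. G (x' + s *\<^sub>R (0,1))) differentiable (at s))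
      \<and> (deriv (\<lambda>s. G (x' + s *\<^sub>R (0,1))) has_real_derivative polar_integral h22 x') (at 0)"
    using has_real_derivative_polar_integral[OF D(1) c1, where v="(0,1)"]
      has_real_derivative_polar_integral[OF D(3) c(3,4), where v="(0,1)"]
    by (intro line) simp_all
  have B: "(Basis :: (real \<times> real) set) = {(1,0),(0,1)}" by (auto simp: Basis_prod_def)
  have "has_second_partials G x'"
    unfolding has_second_partials_def B using l1 l2 by (auto simp: real_differentiable_def)
  moreover have "laplacian G x' = polar_integral h11 x' + polar_integral h22 x'"
    unfolding laplacian_def B
    using DERIV_imp_deriv[OF conjunct2[OF l1]] DERIV_imp_deriv[OF conjunct2[OF l2]] by simp
  then have "laplacian G x' = 8 * pi\<^sup>2 * h x'"
    using polar_integral_laplacian[OF D c h(2) assms(3)] polar_integral_add[OF c(1,4)] by simp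
  then have "f (x', x3) = \<bar>x3\<bar> / (8 * pi\<^sup>2) * laplacian G x'" using h(3)[OF assms(2)] by simp
  ultimately show ?thesis by blast
qed

end
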